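(* Let $\theta_0=1,\theta_1,\ldots,\theta_{m-1}$ ($m\ge3$) be a unimodular partition of the unit circle, with associated homeomorphism $\Phi:[0,1)\to[0,1)$. The function $\Phi$ is purely singular, i.e., $\Phi'=0$ almost everywhere with respect to the Lebesgue measure.
   Context: $S^1=\{z\in\mathbb{C}:|z|=1\}$ is the boundary of the Poincar\'e disk. A pythagorean triple is $\mathbf{t}=(t_1,t_2,t_3)\in\mathbb{Z}^3$ with $t_3>0$, $\gcd(t_1,t_2,t_3)=1$, $t_1^2+t_2^2=t_3^2$; it is identified with the point $\theta=(t_1+t_2i)/t_3\in S^1\cap\mathbb{Q}(i)$. Let $L=\mathrm{diag}(1,1,-1)$ and $\langle \mathbf{x},\mathbf{y}\rangle=\mathbf{x}^\top L\mathbf{y}$. For distinct pythagorean triples $\mathbf{t},\mathbf{t}'$, the closed arc $[\mathbf{t},\mathbf{t}']$ going counterclockwise from $\mathbf{t}$ to $\mathbf{t}'$ is unimodular if $\mathbf{w}=(L\mathbf{t}'\times L\mathbf{t})/\langle\mathbf{t}',\mathbf{t}\rangle\in\mathbb{Z}^3$. A unimodular partition of $S^1$ is a counterclockwise cyclically ordered $m$-tuple $\mathbf{t}_0,\ldots,\mathbf{t}_{m-1}$ of pythagorean triples, $m\ge3$, such that each arc $[\mathbf{t}_a,\mathbf{t}_{a+1}]$ is unimodular (indices modulo $m$); $\theta_a\in S^1$ is the point identified with $\mathbf{t}_a$, and it is assumed that $\theta_0=1$. Let $I_a=[\theta_a,\theta_{a+1})$ be the half-open counterclockwise arc, and let $\mathscr{A}_a$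 be the hyperbolic reflection of the Poincar\'e disk in the geodesic with ideal endpoints $\theta_a,\theta_{a+1}$, acting on $S^1$ by $\mathscr{A}_a*z=\frac{(\theta_a+\theta_{a+1})z-2\theta_a\theta_{a+1}}{2z-(\theta_a+\theta_{a+1})}$. The map $B:S^1\to S^1$ is $B(\sigma)=\mathscr{A}_a*\sigma$ for $\sigma\in I_a$. The circle is identified with $[0,1)$ via $\exp(2\pi i x)\leftrightarrow x$, so that $B$ is viewed as a map $[0,1)\to[0,1)$ (and $I_a\subset[0,1)$); let $T:[0,1)\to[0,1)$, $T(x)=-(m-1)x \pmod 1$. $\Phi$ is the unique homeomorphism of $[0,1)$ (with the topology inherited from $\mathbb{R}$) such that $\Phi\circ B=T\circ\Phi$; explicitly $\Phi=\psi^{-1}\circ\varphi$, where $\varphi(x)=a_0a_1a_2\ldots$ with $B^t(x)\in I_{a_t}$, and $\psi(x)=a_0a_1a_2\ldots$ with $T^t(x)\in J_{a_t}$, $J_a=[a/m,(a+1)/m)$ (the maps $\varphi,\psi$ are injective with the same range in $\{0,\ldots,m-1\}^{\omega}$). *)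

theory Defs
  imports "HOL-Analysis.Analysis"
begin

unbundle cross3_syntax

section \<open>Pythagorean triples and unimodular arcs\<close>

definition pythagorean_triple :: "int ^ 3 \<Rightarrow> bool" where
  "pythagorean_triple t \<longleftrightarrow>
     t $ 3 > 0 \<and> Gcd {t $ 1, t $ 2, t $ 3} = 1 \<and> (t $ 1)\<^sup>2 + (t $ 2)\<^sup>2 = (t $ 3)\<^sup>2"

definition circle_point :: "int ^ 3 \<Rightarrow> complex" where
  "circle_point t = Complex (of_int (t $ 1) / of_int (t $ 3)) (of_int (t $ 2) / of_int (t $ 3))"

definition real_vec :: "int ^ 3 \<Rightarrow> real ^ 3" where
  "real_vec t = (\<chi> i. of_int (t $ i))"

definition Lmat :: "real ^ 3 ^ 3" where
  "Lmat = vector [vector [1, 0, 0], vector [0, 1, 0], vector [0, 0, -1]]"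

definition lorentz :: "real ^ 3 \<Rightarrow> real ^ 3 \<Rightarrow> real" where
  "lorentz x y = x \<bullet> (Lmat *v y)"

definition unimodular_arc :: "int ^ 3 \<Rightarrow> int ^ 3 \<Rightarrow> bool" where
  "unimodular_arc t t' \<longleftrightarrow> t \<noteq> t' \<and>
     (\<forall>i. ((1 / lorentz (real_vec t') (real_vec t)) *\<^sub>R
            ((Lmat *v real_vec t') \<times> (Lmat *v real_vec t))) $ i \<in> \<int>)"

text \<open>
  For points \<open>p\<close>, \<open>q\<close> of the unit circle, \<open>Arg2pi (q / p)\<close> is the angle in \<open>[0, 2\<pi>)\<close> swept when
  going counterclockwise from \<open>p\<close> to \<open>q\<close>. Hence a tuple is counterclockwise cyclically ordered
  iff the angles measured from its first point are strictly increasing.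
\<close>

definition ccw_ordered :: "nat \<Rightarrow> (nat \<Rightarrow> complex) \<Rightarrow> bool" where
  "ccw_ordered m \<theta> \<longleftrightarrow> strict_mono_on {..<m} (\<lambda>a. Arg2pi (\<theta> a / \<theta> 0))"

text \<open>An \<open>m\<close>-tuple is a function on \<open>nat\<close>, of which only the values below \<open>m\<close> are used.\<close>

definition unimodular_partition :: "nat \<Rightarrow> (nat \<Rightarrow> int ^ 3) \<Rightarrow> bool" where
  "unimodular_partition m t \<longleftrightarrow>
     m \<ge> 3 \<and>
     (\<forall>a<m. pythagorean_triple (t a)) \<and>
     ccw_ordered m (\<lambda>a. circle_point (t a)) \<and>
     (\<forall>a<m. unimodular_arc (t a) (t (Suc a mod m)))"

section \<open>The map \<open>B\<close> on the circle\<close>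

definition ccw_arc :: "complex \<Rightarrow> complex \<Rightarrow> complex set" where
  "ccw_arc p q = {z \<in> sphere 0 1. Arg2pi (z / p) < Arg2pi (q / p)}"

definition reflect :: "complex \<Rightarrow> complex \<Rightarrow> complex \<Rightarrow> complex" where
  "reflect p q z = ((p + q) * z - 2 * p * q) / (2 * z - (p + q))"

definition basic_arc :: "nat \<Rightarrow> (nat \<Rightarrow> int ^ 3) \<Rightarrow> nat \<Rightarrow> complex set" where
  "basic_arc m t a = ccw_arc (circle_point (t a)) (circle_point (t (Suc a mod m)))"

definition Bmap :: "nat \<Rightarrow> (nat \<Rightarrow> int ^ 3) \<Rightarrow> complex \<Rightarrow> complex" where
  "Bmap m t z =
     (let a = (THE a. a < m \<and> z \<in> basic_arc m t a)
      in reflect (circle_point (t a)) (circle_point (t (Suc a mod m))) z)"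

section \<open>Identification of the circle with \<open>[0, 1)\<close>\<close>

definition to_circle :: "real \<Rightarrow> complex" where
  "to_circle x = exp (2 * of_real pi * \<i> * of_real x)"

definition of_circle :: "complex \<Rightarrow> real" where
  "of_circle z = Arg2pi z / (2 * pi)"

definition B01 :: "nat \<Rightarrow> (nat \<Rightarrow> int ^ 3) \<Rightarrow> real \<Rightarrow> real" where
  "B01 m t x = of_circle (Bmap m t (to_circle x))"

definition I01 :: "nat \<Rightarrow> (nat \<Rightarrow> int ^ 3) \<Rightarrow> nat \<Rightarrow> real set" where
  "I01 m t a = {x \<in> {0..<1}. to_circle x \<in> basic_arc m t a}"

section \<open>The map \<open>T\<close> and the homeomorphism \<open>\<Phi>\<close>\<close>

definition T01 :: "nat \<Rightarrow> real \<Rightarrow> real" where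
  "T01 m x = frac (- (real m - 1) * x)"

definition J01 :: "nat \<Rightarrow> nat \<Rightarrow> real set" where
  "J01 m a = {real a / real m ..< (real a + 1) / real m}"

definition itinerary :: "nat \<Rightarrow> ('x \<Rightarrow> 'x) \<Rightarrow> (nat \<Rightarrow> 'x set) \<Rightarrow> 'x \<Rightarrow> nat \<Rightarrow> nat" where
  "itinerary m F P x = (\<lambda>n. THE a. a < m \<and> (F ^^ n) x \<in> P a)"

definition \<phi> :: "nat \<Rightarrow> (nat \<Rightarrow> int ^ 3) \<Rightarrow> real \<Rightarrow> nat \<Rightarrow> nat" where
  "\<phi> m t = itinerary m (B01 m t) (I01 m t)"

definition \<psi> :: "nat \<Rightarrow> real \<Rightarrow> nat \<Rightarrow> nat" where
  "\<psi> m = itinerary m (T01 m) (J01 m)"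

text \<open>Only the values of \<open>\<Phi>\<close> on \<open>[0, 1)\<close> are meaningful.\<close>

definition \<Phi> :: "nat \<Rightarrow> (nat \<Rightarrow> int ^ 3) \<Rightarrow> real \<Rightarrow> real" where
  "\<Phi> m t x = inv_into {0..<1} (\<psi> m) (\<phi> m t x)"

definition purely_singular :: "(real \<Rightarrow> real) \<Rightarrow> bool" where
  "purely_singular f \<longleftrightarrow>
     (AE x in lebesgue_on {0..<1}. (f has_real_derivative 0) (at x within {0..<1}))"

end

theory Submission
  imports Defs
begin

text \<open>
  Lift everything to the real line. The points \<open>\<theta>\<^sub>a\<close> become a periodic increasing sequence \<open>p :: int \<Rightarrow> real\<close>, and
  \<open>B\<close> becomes a map that sends each cell \<open>[p a, p (a + 1)]\<close> decreasingly onto \<open>[p (a + 1) - 1, p a]\<close>. The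
  conjugacy equation \<open>\<Phi> x = (a - \<Phi> (B x)) / (m - 1)\<close> on the cell \<open>a\<close> is a contraction, whose fixed point is
  increasing and continuous; it coincides with \<open>\<Phi>\<close>, as \<open>T\<close> is expanding. By Lebesgue's theorem on monotone
  functions (proved with the Vitali covering theorem) \<open>\<Phi>\<close> is differentiable almost everywhere.

  It remains to see that no finite derivative is nonzero. Consider two adjacent cells meeting at \<open>w\<close>. The
  product of the two reflections is parabolic with fixed point \<open>w\<close>, so alternating between them produces
  points \<open>z\<^sub>0, z\<^sub>1, z\<^sub>2\<close> which are in arithmetic progression in a coordinate with \<open>w\<close> at infinity, whereas the
  \<open>\<Phi>\<close>-distances from \<open>z\<^sub>k\<close> to \<open>w\<close> are proportional to \<open>(m - 1)\<^sup>-\<^sup>k\<close>. Both properties are transported by the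
  inverse branches of \<open>B\<close> into arbitrarily small cells around any given point. If \<open>\<Phi>\<close> were almost linear
  there, then the distances \<open>\<bar>z\<^sub>k - w\<bar>\<close> would be nearly proportional both to \<open>(m - 1)\<^sup>-\<^sup>k\<close> and to the reciprocals of an
  arithmetic progression, which is impossible for \<open>m \<ge> 3\<close>.
\<close>

section \<open>Differentiability of monotone functions\<close>

text \<open>The Vitali theorem for balls applies with midpoints as centres and half-lengths as
  radii. The intervals need only contain the point, not be centred at it, and openness of
  \<open>U\<close> lets sufficiently short ones stay inside \<open>U\<close>.\<close>

lemma Vitali_intervals:
  fixes S U :: "real set" and P :: "real \<Rightarrow> real \<Rightarrow> bool"
  assumes "open U" "S \<subseteq> U"
    and P: "\<And>x d. x \<in> S \<Longrightarrow> d > 0 \<Longrightarrow> \<exists>a b. a \<le> x \<and> x \<le> b \<and> a < b \<and> b - a < d \<and> P a b"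
  obtains C :: "(real \<times> real) set" where "countable C"
    and "\<And>a b. (a, b) \<in> C \<Longrightarrow> a < b \<and> {a..b} \<subseteq> U \<and> P a b"
    and "disjoint_family_on (\<lambda>(a, b). {a..b}) C"
    and "negligible (S - (\<Union>(a, b)\<in>C. {a..b}))"
proof -
  define K where "K = {(a, b). a < b \<and> {a..b} \<subseteq> U \<and> P a b}"
  define c where "c = (\<lambda>(a::real, b). (a + b) / 2)"
  define r where "r = (\<lambda>(a::real, b). (b - a) / 2)"
  have cball: "cball (c i) (r i) = (\<lambda>(a, b). {a..b}) i" for i
    by (auto simp: c_def r_def cball_def dist_real_def abs_le_iff field_simps split: prod.splits)
  have 1: "0 < r i" if "i \<in> K" for i
    using that by (auto simp: K_def r_def)
  have 2: "\<exists>i. i \<in> K \<and> x \<in> cball (c i) (r i) \<and> r i < d" if x: "x \<in> S" and "0 < d" for x d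
  proof -
    obtain e where e: "e > 0" "ball x e \<subseteq> U"
      using openE[OF assms(1), of x] assms(2) x by blast
    obtain a b where ab: "a \<le> x" "x \<le> b" "a < b" "b - a < min d e" "P a b"
      using P[OF x, of "min d e"] e(1) \<open>0 < d\<close> by auto
    have "{a..b} \<subseteq> ball x e"
      using ab by (auto simp: dist_real_def)
    then show ?thesis
      using ab e(2) by (intro exI[of _ "(a, b)"]) (auto simp: K_def cball, auto simp: r_def)
  qed
  obtain C where C: "countable C" "C \<subseteq> K"
     "pairwise (\<lambda>i j. disjnt (cball (c i) (r i)) (cball (c j) (r j))) C"
     "negligible (S - (\<Union>i \<in> C. cball (c i) (r i)))"
    by (rule Vitali_covering_theorem_cballs[of K r S c, OF 1 2])
  show thesis
  proof (rule that)
    show "disjoint_family_on (\<lambda>(a, b). {a..b}) C"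
      using C(3) by (auto simp: cball disjoint_family_on_def pairwise_def disjnt_def)
    show "negligible (S - (\<Union>(a, b)\<in>C. {a..b}))"
      using C(4) by (simp add: cball)
  qed (use C(1,2) in \<open>auto simp: K_def\<close>)
qed

text \<open>Outer measure is used because the sets of points with prescribed slopes are not shown to
  be measurable.\<close>

lemma outer_measure_of_Un_negligible:
  assumes "negligible N" "S \<subseteq> N \<union> D" "D \<in> sets lebesgue"
  shows "outer_measure_of lebesgue S \<le> emeasure lebesgue D"
proof -
  have N: "N \<in> null_sets lebesgue"
    using assms(1) negligible_iff_null_sets by blast
  have "outer_measure_of lebesgue S \<le> outer_measure_of lebesgue (D \<union> N)"
    using assms(2) by (intro outer_measure_of_mono) auto
  also have "\<dots> = emeasure lebesgue (D \<union> N)"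
    using N assms(3) by (intro outer_measure_of_eq) auto
  also have "\<dots> = emeasure lebesgue D"
    using N assms(3) by (intro emeasure_Un_null_set)
  finally show ?thesis .
qed

lemma outer_measure_of_lebesgue_open:
  assumes "outer_measure_of lebesgue S < c"
  obtains U where "open U" "S \<subseteq> U" "emeasure lebesgue U < c"
proof -
  obtain E where E: "E \<in> sets lebesgue" "S \<subseteq> E" "outer_measure_of lebesgue S = emeasure lebesgue E"
    using outer_measure_of_attain[of S lebesgue] by auto
  \<comment> \<open>As \<open>c\<close> may be infinite, the slack \<open>e\<close> is measured up
    to a finite \<open>d\<close> strictly between the measure of \<open>E\<close> and
    \<open>c\<close>.\<close>
  obtain e where e: "e > 0" "emeasure lebesgue E + ennreal e < c"
  proof -
    have "emeasure lebesgue E < c" using assms E by simp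
    then obtain d where d: "emeasure lebesgue E < d" "d < c" using dense by blast
    have "emeasure lebesgue E < top" using d(1) less_le_trans top_greatest by blast
    then obtain x where x: "x \<ge> 0" "emeasure lebesgue E = ennreal x"
      by (cases "emeasure lebesgue E") auto
    have "d < top" using d(2) less_le_trans top_greatest by blast
    then obtain y where y: "y \<ge> 0" "d = ennreal y" by (cases d) auto
    have "x < y" using d(1) x y by (simp add: ennreal_less_iff)
    then have "emeasure lebesgue E + ennreal (y - x) = d"
      using x y by (simp flip: ennreal_plus)
    then show thesis using that[of "y - x"] \<open>x < y\<close> d(2) by simp
  qed
  obtain T where T: "open T" "E \<subseteq> T" "T - E \<in> lmeasurable" "emeasure lebesgue (T - E) < ennreal e"
    using sets_lebesgue_outer_open[OF E(1) e(1)] .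
  have "emeasure lebesgue T \<le> emeasure lebesgue (E \<union> (T - E))"
    using T E by (intro emeasure_mono) auto
  also have "\<dots> \<le> emeasure lebesgue E + emeasure lebesgue (T - E)"
    using T E by (intro emeasure_subadditive) auto
  also have "\<dots> \<le> emeasure lebesgue E + ennreal e"
    using T(4) by (intro add_left_mono) auto
  finally have "emeasure lebesgue T < c" using e(2) by simp
  then show thesis using that[of T] T E by auto
qed

lemma outer_measure_of_zero_negligible:
  assumes "outer_measure_of lebesgue S = 0"
  shows "negligible S"
proof -
  obtain E where E: "E \<in> sets lebesgue" "S \<subseteq> E" "outer_measure_of lebesgue S = emeasure lebesgue E"
    using outer_measure_of_attain[of S lebesgue] by auto
  then have "negligible E" using assms by (simp add: negligible_iff_null_sets null_sets_def)
  then show ?thesis using E(2) negligible_subset by blast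
qed

section \<open>Slopes of a monotone function, comparing Lebesgue and Stieltjes measure\<close>

context
  fixes f :: "real \<Rightarrow> real"
  assumes mono: "mono f" and cont: "continuous_on UNIV f"
begin

text \<open>A two-sided substitute for a Dini derivate: the intervals may have the point inside or
  at either end. This is exactly the shape of a Vitali cover, and its negation bounds left and right
  difference quotients at once.\<close>

definition slope_below :: "real \<Rightarrow> real \<Rightarrow> bool" where
  "slope_below q x \<longleftrightarrow> (\<forall>d>0. \<exists>a b. a \<le> x \<and> x \<le> b \<and> a < b \<and> b - a < d \<and> f b - f a < q * (b - a))"

definition slope_above :: "real \<Rightarrow> real \<Rightarrow> bool" where
  "slope_above q x \<longleftrightarrow> (\<forall>d>0. \<exists>a b. a \<le> x \<and> x \<le> b \<and> a < b \<and> b - a < d \<and> f b - f a > q * (b - a))"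

lemma emeasure_stieltjes_Icc: "a \<le> b \<Longrightarrow> emeasure (interval_measure f) {a..b} = ennreal (f b - f a)"
  by (rule emeasure_interval_measure_Icc) (use mono cont in \<open>auto simp: mono_def\<close>)

text \<open>Disjoint intervals from a Vitali cover exhaust \<open>S\<close> up to a null set, and
  the Stieltjes measure of each is at least \<open>q\<close> times its length.\<close>

lemma slope_above_outer_measure:
  assumes S: "\<And>x. x \<in> S \<Longrightarrow> slope_above q x" and U: "open U" "S \<subseteq> U" and q: "q \<ge> 0"
  shows "ennreal q * outer_measure_of lebesgue S \<le> emeasure (interval_measure f) U"
proof -
  obtain C where C: "countable C"
    and ab: "\<And>a b. (a, b) \<in> C \<Longrightarrow> a < b \<and> {a..b} \<subseteq> U \<and> f b - f a > q * (b - a)"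
    and disj: "disjoint_family_on (\<lambda>(a, b). {a..b}) C"
    and neg: "negligible (S - (\<Union>(a, b)\<in>C. {a..b}))"
    by (rule Vitali_intervals[OF U, of "\<lambda>a b. f b - f a > q * (b - a)"])
       (use S in \<open>auto simp: slope_above_def\<close>)
  define D where "D = (\<Union>(a, b)\<in>C. {a..b})"
  have D: "D \<in> sets borel" unfolding D_def using C by (intro sets.countable_UN'') auto
  have "outer_measure_of lebesgue S \<le> emeasure lebesgue D"
    by (rule outer_measure_of_Un_negligible[OF neg]) (use D in \<open>auto simp: D_def[symmetric]\<close>)
  also have "emeasure lebesgue D = emeasure lborel D" using D by simp
  also have "\<dots> = (\<integral>\<^sup>+ i. emeasure lborel ((\<lambda>(a, b). {a..b}) i) \<partial>count_space C)"
    unfolding D_def by (rule emeasure_UN_countable) (use C disj in auto)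
  finally have "ennreal q * outer_measure_of lebesgue S \<le> 
     ennreal q * (\<integral>\<^sup>+ i. emeasure lborel ((\<lambda>(a, b). {a..b}) i) \<partial>count_space C)"
    by (intro mult_left_mono) auto
  also have "\<dots> = (\<integral>\<^sup>+ i. ennreal q * emeasure lborel ((\<lambda>(a, b). {a..b}) i) \<partial>count_space C)"
    by (intro nn_integral_cmult[symmetric]) auto
  also have "\<dots> \<le> (\<integral>\<^sup>+ i. emeasure (interval_measure f) ((\<lambda>(a, b). {a..b}) i) \<partial>count_space C)"
  proof (rule nn_integral_mono, clarsimp)
    fix a b assume "(a, b) \<in> C"
    with ab[of a b] show "ennreal q * emeasure lborel {a..b} \<le> emeasure (interval_measure f) {a..b}"
      using q by (auto simp: emeasure_stieltjes_Icc ennreal_mult[symmetric] intro!: ennreal_leI)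
  qed
  also have "\<dots> = emeasure (interval_measure f) D"
    unfolding D_def by (rule emeasure_UN_countable[symmetric]) (use C disj in auto)
  also have "\<dots> \<le> emeasure (interval_measure f) U"
    using ab U by (intro emeasure_mono) (auto simp: D_def)
  finally show ?thesis .
qed

text \<open>The dual estimate. \<open>V\<close> consists of the open interiors of the covering
  intervals: dropping their countably many endpoints costs only a null set, and an open set is what
  \<open>slope_above_outer_measure\<close> can be applied to next.\<close>

lemma slope_below_cover:
  assumes S: "\<And>x. x \<in> S \<Longrightarrow> slope_below p x" and U: "open U" "S \<subseteq> U" and p: "p \<ge> 0"
  obtains V where "open V" "negligible (S - V)" 
    "emeasure (interval_measure f) V \<le> ennreal p * emeasure lebesgue U"
proof -
  obtain C where C: "countable C"
    and ab: "\<And>a b. (a, b) \<in> C \<Longrightarrow> a < b \<and> {a..b} \<subseteq> U \<and> f b - f a < p * (b - a)"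
    and disj: "disjoint_family_on (\<lambda>(a, b). {a..b}) C"
    and neg: "negligible (S - (\<Union>(a, b)\<in>C. {a..b}))"
    by (rule Vitali_intervals[OF U, of "\<lambda>a b. f b - f a < p * (b - a)"])
       (use S in \<open>auto simp: slope_below_def\<close>)
  define D where "D = (\<Union>(a, b)\<in>C. {a..b})"
  define V where "V = (\<Union>(a, b)\<in>C. {a<..<b})"
  have D: "D \<in> sets borel" unfolding D_def using C by (intro sets.countable_UN'') auto
  have "countable (fst ` C \<union> snd ` C)" using C by auto
  then have "negligible (fst ` C \<union> snd ` C)"
    by (simp add: negligible_iff_null_sets countable_imp_null_set_lborel null_sets_completionI)
  moreover have "S - V \<subseteq> (S - D) \<union> (fst ` C \<union> snd ` C)"
    unfolding V_def D_def by (force simp: order.order_iff_strict)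
  ultimately have negV: "negligible (S - V)"
    using neg unfolding D_def[symmetric] by (meson negligible_Un negligible_subset)
  have "emeasure (interval_measure f) V \<le> emeasure (interval_measure f) D"
  proof (rule emeasure_mono)
    show "V \<subseteq> D" unfolding D_def V_def by (intro UN_mono) auto
  qed (use D in simp)
  also have "\<dots> = (\<integral>\<^sup>+ i. emeasure (interval_measure f) ((\<lambda>(a, b). {a..b}) i) \<partial>count_space C)"
    unfolding D_def by (rule emeasure_UN_countable) (use C disj in auto)
  also have "\<dots> \<le> (\<integral>\<^sup>+ i. ennreal p * emeasure lborel ((\<lambda>(a, b). {a..b}) i) \<partial>count_space C)"
  proof (rule nn_integral_mono, clarsimp)
    fix a b assume "(a, b) \<in> C"
    with ab[of a b] show "emeasure (interval_measure f) {a..b} \<le> ennreal p * emeasure lborel {a..b}"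
      using p by (auto simp: emeasure_stieltjes_Icc ennreal_mult[symmetric] intro!: ennreal_leI)
  qed
  also have "\<dots> = ennreal p * (\<integral>\<^sup>+ i. emeasure lborel ((\<lambda>(a, b). {a..b}) i) \<partial>count_space C)"
    by (intro nn_integral_cmult) auto
  also have "\<dots> = ennreal p * emeasure lborel D"
    unfolding D_def by (subst emeasure_UN_countable) (use C disj in auto)
  also have "\<dots> \<le> ennreal p * emeasure lborel U"
    using ab U by (intro mult_left_mono emeasure_mono) (auto simp: D_def)
  also have "\<dots> = ennreal p * emeasure lebesgue U" using U by simp
  finally have *: "emeasure (interval_measure f) V \<le> ennreal p * emeasure lebesgue U" .
  have "open V" unfolding V_def by auto
  then show thesis using that negV * by blast
qed

text \<open>Chaining both estimates on a bounded piece of finite outer measure \<open>s\<close>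
  gives \<open>q * s \<le> p * (s + e)\<close> for all \<open>e > 0\<close>, which forces
  \<open>s = 0\<close>.\<close>

lemma negligible_oscillating_slopes:
  assumes "0 \<le> p" "p < q"
  shows "negligible {x. slope_below p x \<and> slope_above q x}"
proof -
  have "negligible ({x. slope_below p x \<and> slope_above q x} \<inter> {- real n<..<real n})" for n
  proof -
    define S where "S = {x. slope_below p x \<and> slope_above q x} \<inter> {- real n<..<real n}"
    have "outer_measure_of lebesgue S \<le> outer_measure_of lebesgue {- real n<..<real n}"
      by (intro outer_measure_of_mono) (auto simp: S_def)
    also have "\<dots> < top" by (simp add: emeasure_lborel_Ioo)
    finally obtain s where s: "outer_measure_of lebesgue S = ennreal s" "s \<ge> 0"
      by (cases "outer_measure_of lebesgue S") auto
    have "q * s \<le> p * (s + e)" if "e > 0" for e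
    proof -
      have "outer_measure_of lebesgue S < ennreal (s + e)" using s that by (simp add: ennreal_lessI)
      then obtain U where U: "open U" "S \<subseteq> U" "emeasure lebesgue U < ennreal (s + e)"
        by (rule outer_measure_of_lebesgue_open)
      obtain V where V: "open V" "negligible (S - V)" 
        "emeasure (interval_measure f) V \<le> ennreal p * emeasure lebesgue U"
        by (rule slope_below_cover[OF _ U(1,2) assms(1)]) (auto simp: S_def)
      obtain E where E: "E \<in> sets lebesgue" "S \<inter> V \<subseteq> E" "outer_measure_of lebesgue (S \<inter> V) = emeasure lebesgue E"
        using outer_measure_of_attain[of "S \<inter> V" lebesgue] by auto
      have "ennreal (q * s) = ennreal q * outer_measure_of lebesgue S"
        using s assms by (simp add: ennreal_mult)
      also have "\<dots> \<le> ennreal q * outer_measure_of lebesgue (S \<inter> V)"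
        unfolding E(3) using V(2) E by (intro mult_left_mono outer_measure_of_Un_negligible[where N="S - V"]) auto
      also have "\<dots> \<le> emeasure (interval_measure f) V"
        using V(1) assms by (intro slope_above_outer_measure) (auto simp: S_def)
      also have "\<dots> \<le> ennreal p * ennreal (s + e)"
        by (rule order_trans[OF V(3)]) (use U(3) in \<open>auto intro!: mult_left_mono\<close>)
      finally have "ennreal (q * s) \<le> ennreal (p * (s + e))"
        using assms s that by (subst ennreal_mult) auto
      then show ?thesis using assms s that by (subst (asm) ennreal_le_iff) auto
    qed
    then have le: "q * s \<le> p * s + p * e" if "e > 0" for e using that by (auto simp: algebra_simps)
    have "q * s \<le> p * s"
    \<comment> \<open>For positive \<open>p\<close> the slack \<open>e / p\<close> produces the
      error \<open>e\<close>; for \<open>p = 0\<close> any single slack already suffices.\<close>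
    proof (cases "p = 0")
      case False
      show ?thesis
      proof (rule field_le_epsilon)
        fix e :: real assume "e > 0"
        then show "q * s \<le> p * s + e" using le[of "e / p"] assms False by simp
      qed
    qed (use le[of 1] in auto)
    then have "(q - p) * s \<le> 0" by (simp add: algebra_simps)
    then have "s \<le> 0" using assms by (simp add: mult_le_0_iff)
    then show ?thesis using s outer_measure_of_zero_negligible[of S] by (simp add: S_def)
  qed
  then have "negligible (\<Union>n. {x. slope_below p x \<and> slope_above q x} \<inter> {- real n<..<real n})"
    by (intro negligible_countable_Union) auto
  moreover have "\<exists>n. x \<in> {- real n<..<real n}" for x
  proof -
    obtain n where "\<bar>x\<bar> < real n" using reals_Archimedean2 by blast
    then have "x \<in> {- real n<..<real n}" by simp linarith
    then show ?thesis ..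
  qed
  then have "(\<Union>n. {x. slope_below p x \<and> slope_above q x} \<inter> {- real n<..<real n}) = {x. slope_below p x \<and> slope_above q x}"
    by blast
  ultimately show ?thesis by simp
qed

text \<open>On a bounded piece, every multiple \<open>n\<close> of the outer measure stays below the
  fixed increment \<open>f k - f (-k)\<close>.\<close>

lemma negligible_infinite_slope:
  "negligible {x. \<forall>n::nat. slope_above (real n) x}"
proof -
  have "negligible ({x. \<forall>n::nat. slope_above (real n) x} \<inter> {- real k<..<real k})" for k
  proof -
    define S where "S = {x. \<forall>n::nat. slope_above (real n) x} \<inter> {- real k<..<real k}"
    have *: "ennreal n * outer_measure_of lebesgue S \<le> ennreal (f k - f (-k))" for n :: nat
    proof -
      have "ennreal n * outer_measure_of lebesgue S \<le> emeasure (interval_measure f) {- real k<..<real k}"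
        by (intro slope_above_outer_measure) (auto simp: S_def)
      also have "\<dots> \<le> emeasure (interval_measure f) {- real k..real k}"
        by (intro emeasure_mono) auto
      finally show ?thesis by (simp add: emeasure_stieltjes_Icc)
    qed
    have "outer_measure_of lebesgue S \<le> outer_measure_of lebesgue {- real k<..<real k}"
      by (intro outer_measure_of_mono) (auto simp: S_def)
    also have "\<dots> < top" by (simp add: emeasure_lborel_Ioo)
    finally obtain s where s: "outer_measure_of lebesgue S = ennreal s" "s \<ge> 0"
      by (cases "outer_measure_of lebesgue S") auto
    have fk: "0 \<le> f k - f (-k)" using mono by (auto simp: mono_def)
    have "n * s \<le> f k - f (-k)" for n :: nat
      using *[of n] s fk by (simp add: ennreal_mult[symmetric])
    then have "s \<le> 0" using reals_Archimedean3[of s] by (meson not_le)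
    then show ?thesis using s outer_measure_of_zero_negligible[of S] by (simp add: S_def)
  qed
  then have "negligible (\<Union>k. {x. \<forall>n::nat. slope_above (real n) x} \<inter> {- real k<..<real k})"
    by (intro negligible_countable_Union) auto
  moreover have "\<exists>n. x \<in> {- real n<..<real n}" for x
  proof -
    obtain n where "\<bar>x\<bar> < real n" using reals_Archimedean2 by blast
    then have "x \<in> {- real n<..<real n}" by simp linarith
    then show ?thesis ..
  qed
  then have "(\<Union>k. {x. \<forall>n::nat. slope_above (real n) x} \<inter> {- real k<..<real k}) = {x. \<forall>n::nat. slope_above (real n) x}"
    by blast
  ultimately show ?thesis by simp
qed

text \<open>The derivative is the infimum of the slopes \<open>q\<close> that fail
  \<open>slope_above q x\<close>. By monotonicity in the slope nothing above it is exceeded; a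
  smaller slope in \<open>slope_below\<close> would produce an excluded rational pair.\<close>

lemma differentiable_if_slopes:
  assumes inf: "\<not> (\<forall>n::nat. slope_above (real n) x)"
    and osc: "\<And>p q. p \<in> \<rat> \<Longrightarrow> q \<in> \<rat> \<Longrightarrow> 0 \<le> p \<Longrightarrow> p < q \<Longrightarrow> \<not> (slope_below p x \<and> slope_above q x)"
  shows "\<exists>D. (f has_real_derivative D) (at x)"
proof -
  define A where "A = {q. \<not> slope_above q x}"
  have nonneg: "0 \<le> q" if "q \<in> A" for q
  proof (rule ccontr)
    assume "\<not> 0 \<le> q"
    have "slope_above q x" unfolding slope_above_def
    proof (intro allI impI)
      fix d :: real assume "d > 0"
      have "f x \<le> f (x + d/2)" using mono \<open>d > 0\<close> by (auto simp: mono_def)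
      then show "\<exists>a b. a \<le> x \<and> x \<le> b \<and> a < b \<and> b - a < d \<and> q * (b - a) < f b - f a"
        using \<open>d > 0\<close> \<open>\<not> 0 \<le> q\<close> mult_neg_pos[of q "d/2"] by (intro exI[of _ x] exI[of _ "x + d/2"]) auto
    qed
    then show False using that by (simp add: A_def)
  qed
  have ne: "A \<noteq> {}" using inf by (auto simp: A_def)
  have bdd: "bdd_below A" using nonneg by (intro bdd_belowI)
  define D where "D = Inf A"
  have up: "\<not> slope_above q x" if "q > D" for q
  proof -
    obtain r where r: "r \<in> A" "r < q" using \<open>q > D\<close> unfolding D_def using cInf_lessD[OF ne] by blast
    have "slope_above r x" if "slope_above q x"
      unfolding slope_above_def
    proof (intro allI impI)
      fix d :: real assume "d > 0"
      then obtain a b where ab: "a \<le> x \<and> x \<le> b \<and> a < b \<and> b - a < d \<and> f b - f a > q * (b - a)"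
        using \<open>slope_above q x\<close> unfolding slope_above_def by meson
      moreover have "r * (b - a) \<le> q * (b - a)" using r ab by (intro mult_right_mono) auto
      then have "f b - f a > r * (b - a)" using ab by linarith
      ultimately show "\<exists>a b. a \<le> x \<and> x \<le> b \<and> a < b \<and> b - a < d \<and> f b - f a > r * (b - a)"
        by (intro exI[of _ a] exI[of _ b]) auto
    qed
    then show ?thesis using r by (auto simp: A_def)
  qed
  have low: "\<not> slope_below p x" if "p < D" for p
  proof
    assume "slope_below p x"
    \<comment> \<open>The hypothesis \<open>osc\<close> concerns nonnegative slopes only; for
      \<open>p \<le> 0\<close> monotonicity of \<open>f\<close> already contradicts
      \<open>slope_below p x\<close>.\<close>
    have "\<not> p \<le> 0"
    proof
      assume "p \<le> 0"
      from \<open>slope_below p x\<close> obtain a b where "a < b" "f b - f a < p * (b - a)"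
        unfolding slope_below_def using zero_less_one by meson
      moreover have "p * (b - a) \<le> 0" using \<open>p \<le> 0\<close> \<open>a < b\<close> by (simp add: mult_nonpos_nonneg)
      moreover have "f a \<le> f b" using mono \<open>a < b\<close> by (auto simp: mono_def)
      ultimately show False by linarith
    qed
    \<comment> \<open>Two rationals below \<open>D\<close>: \<open>slope_below\<close> passes from
      \<open>p\<close> up to \<open>r\<close>, while \<open>s < D\<close> lies outside
      \<open>A\<close>, so that \<open>slope_above s x\<close> holds.\<close>
    obtain r where r: "p < r" "r < D" "r \<in> \<rat>" using Rats_dense_in_real \<open>p < D\<close> by blast
    obtain s where s: "r < s" "s < D" "s \<in> \<rat>" using Rats_dense_in_real \<open>r < D\<close> by blast
    have "slope_below r x" unfolding slope_below_def
    proof (intro allI impI)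
      fix d :: real assume "d > 0"
      then obtain a b where ab: "a \<le> x \<and> x \<le> b \<and> a < b \<and> b - a < d \<and> f b - f a < p * (b - a)"
        using \<open>slope_below p x\<close> unfolding slope_below_def by meson
      moreover have "p * (b - a) \<le> r * (b - a)" using r ab by (intro mult_right_mono) auto
      then have "f b - f a < r * (b - a)" using ab by linarith
      ultimately show "\<exists>a b. a \<le> x \<and> x \<le> b \<and> a < b \<and> b - a < d \<and> f b - f a < r * (b - a)"
        by (intro exI[of _ a] exI[of _ b]) auto
    qed
    moreover have "slope_above s x" using s(2) bdd cInf_lower[of s A] unfolding D_def A_def by force
    ultimately show False using osc[of r s] r s \<open>\<not> p \<le> 0\<close> by auto
  qed
  have "(f has_real_derivative D) (at x)"
    unfolding has_field_derivative_iff
  proof (rule LIM_I)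
    fix e :: real assume "e > 0"
    obtain d1 where d1: "d1 > 0" "\<And>a b. a \<le> x \<Longrightarrow> x \<le> b \<Longrightarrow> a < b \<Longrightarrow> b - a < d1 \<Longrightarrow> f b - f a \<le> (D + e/2) * (b - a)"
    proof -
      have "\<not> slope_above (D + e/2) x" using up \<open>e > 0\<close> by simp
      then show thesis using that unfolding slope_above_def by (meson not_less)
    qed
    obtain d2 where d2: "d2 > 0" "\<And>a b. a \<le> x \<Longrightarrow> x \<le> b \<Longrightarrow> a < b \<Longrightarrow> b - a < d2 \<Longrightarrow> f b - f a \<ge> (D - e/2) * (b - a)"
    proof -
      have "\<not> slope_below (D - e/2) x" using low \<open>e > 0\<close> by simp
      then show thesis using that unfolding slope_below_def by (meson not_less)
    qed
    have "norm ((f y - f x) / (y - x) - D) < e" if y: "y \<noteq> x" "norm (y - x) < min d1 d2" for y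
    proof (cases "x < y")
      case True
      then have "f y - f x \<le> (D + e/2) * (y - x)" "f y - f x \<ge> (D - e/2) * (y - x)"
        using d1(2)[of x y] d2(2)[of x y] y by auto
      then have "(f y - f x) / (y - x) \<le> D + e/2" "(f y - f x) / (y - x) \<ge> D - e/2"
        using True by (auto simp: field_simps)
      then show ?thesis using \<open>e > 0\<close> by (auto simp: abs_if)
    next
      case False
      then have "f x - f y \<le> (D + e/2) * (x - y)" "f x - f y \<ge> (D - e/2) * (x - y)"
        using d1(2)[of y x] d2(2)[of y x] y by auto
      then have "(f x - f y) / (x - y) \<le> D + e/2" "(f x - f y) / (x - y) \<ge> D - e/2"
        using False y by (auto simp: divide_simps)
      moreover have "(f x - f y) / (x - y) = (f y - f x) / (y - x)"
        by (metis minus_diff_eq minus_divide_divide)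
      ultimately show ?thesis using \<open>e > 0\<close> by (auto simp: abs_if)
    qed
    then show "\<exists>s>0. \<forall>y. y \<noteq> x \<and> norm (y - x) < s \<longrightarrow> norm ((f y - f x) / (y - x) - D) < e"
      using d1(1) d2(1) by (intro exI[of _ "min d1 d2"]) auto
  qed
  then show ?thesis by blast
qed

end

text \<open>Rational pairs of slopes make the exceptional set a countable union of null
  sets.\<close>

theorem AE_differentiable_mono:
  fixes f :: "real \<Rightarrow> real"
  assumes "mono f" "continuous_on UNIV f"
  shows "AE x in lebesgue. \<exists>D. (f has_real_derivative D) (at x)"
proof -
  define N where "N = {x. \<forall>n::nat. slope_above f (real n) x} \<union>
    (\<Union>(p, q) \<in> {(p, q). p \<in> \<rat> \<and> q \<in> \<rat> \<and> 0 \<le> p \<and> p < q}. {x. slope_below f p x \<and> slope_above f q x})"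
  have "countable {(p::real, q::real). p \<in> \<rat> \<and> q \<in> \<rat> \<and> 0 \<le> p \<and> p < q}"
    by (rule countable_subset[of _ "Sigma \<rat> (\<lambda>_. \<rat>)"]) (auto intro: countable_rat)
  then have "negligible N"
    unfolding N_def using negligible_infinite_slope[OF assms] negligible_oscillating_slopes[OF assms]
    by (intro negligible_Un negligible_countable_Union countable_image) auto
  then have "N \<in> null_sets lebesgue" by (simp add: negligible_iff_null_sets)
  moreover have "\<exists>D. (f has_real_derivative D) (at x)" if "x \<notin> N" for x
    by (rule differentiable_if_slopes[OF assms]) (use that in \<open>auto simp: N_def\<close>)
  ultimately show ?thesis by (intro AE_I'[of N]) auto
qed

section \<open>Reflections and their lifts to the real line\<close>

lemma to_circle_cis: "to_circle x = cis (2 * pi * x)"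
  by (simp add: to_circle_def cis_conv_exp mult_ac)

lemma norm_to_circle [simp]: "norm (to_circle x) = 1"
  by (simp add: to_circle_cis)

lemma to_circle_nonzero [simp]: "to_circle x \<noteq> 0"
  by (simp add: to_circle_cis)

lemma to_circle_add: "to_circle (x + y) = to_circle x * to_circle y"
  by (simp add: to_circle_cis cis_mult ring_distribs)

lemma to_circle_diff: "to_circle (x - y) = to_circle x / to_circle y"
  by (simp add: to_circle_cis cis_divide right_diff_distrib)

lemma to_circle_0 [simp]: "to_circle 0 = 1"
  by (simp add: to_circle_cis)

lemma to_circle_of_int [simp]: "to_circle (of_int n) = 1"
  by (simp add: to_circle_cis cis_multiple_2pi)

lemma to_circle_1 [simp]: "to_circle 1 = 1"
  using to_circle_of_int[of 1] by simp

lemma dist_to_circle: "norm (to_circle x - to_circle y) = 2 * \<bar>sin (pi * (x - y))\<bar>"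
proof -
  have "to_circle x - to_circle y = cis (pi * (x + y)) * (cis (pi * (x - y)) - cis (- (pi * (x - y))))"
    by (simp add: to_circle_cis right_diff_distrib cis_mult algebra_simps)
  also have "cis (pi * (x - y)) - cis (- (pi * (x - y))) = 2 * \<i> * of_real (sin (pi * (x - y)))"
    by (simp add: complex_eq_iff)
  finally show ?thesis by (simp add: norm_mult)
qed

lemma to_circle_eq_iff: "to_circle x = to_circle y \<longleftrightarrow> x - y \<in> \<int>"
proof -
  have "to_circle x = to_circle y \<longleftrightarrow> sin (pi * (x - y)) = 0"
    using dist_to_circle[of x y] by (metis abs_eq_0 eq_iff_diff_eq_0 mult_eq_0_iff norm_eq_zero zero_neq_numeral)
  also have "\<dots> \<longleftrightarrow> x - y \<in> \<int>"
    by (auto simp: sin_zero_iff_int2 Ints_def)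
  finally show ?thesis .
qed

lemma to_circle_neq:
  assumes "\<bar>x - y\<bar> < 1" "x \<noteq> y"
  shows "to_circle x \<noteq> to_circle y"
  unfolding to_circle_eq_iff
proof
  assume "x - y \<in> \<int>"
  then obtain k where k: "x - y = of_int k" by (auto elim: Ints_cases)
  then have "k \<noteq> 0" using assms(2) by auto
  then have "1 \<le> \<bar>k\<bar>" by simp
  then have "1 \<le> \<bar>x - y\<bar>" unfolding k by linarith
  then show False using assms(1) by simp
qed

text \<open>Up to the factor \<open>\<i>\<close>, the Cayley transform sending
  \<open>to_circle p\<close> to infinity is a cotangent of the half angle. This gives a real
  coordinate in which reflections become affine.\<close>

lemma to_circle_cot:
  assumes "to_circle x \<noteq> to_circle p"
  shows "of_real (cot (pi * (x - p))) = \<i> * (to_circle x + to_circle p) / (to_circle x - to_circle p)"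
proof -
  let ?e = "cis (pi * (x + p))"
  have 1: "to_circle x - to_circle p = ?e * (cis (pi * (x - p)) - cis (- (pi * (x - p))))"
    by (simp add: to_circle_cis right_diff_distrib cis_mult algebra_simps)
  have 2: "cis (pi * (x - p)) - cis (- (pi * (x - p))) = 2 * \<i> * of_real (sin (pi * (x - p)))"
    by (simp add: complex_eq_iff)
  have 3: "to_circle x + to_circle p = ?e * (cis (pi * (x - p)) + cis (- (pi * (x - p))))"
    by (simp add: to_circle_cis distrib_left cis_mult algebra_simps)
  have 4: "cis (pi * (x - p)) + cis (- (pi * (x - p))) = 2 * of_real (cos (pi * (x - p)))"
    by (simp add: complex_eq_iff)
  have "sin (pi * (x - p)) \<noteq> 0"
    using assms 1 2 by auto
  then show ?thesis
    unfolding 1 2 3 4 by (simp add: cot_def)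
qed

section \<open>Reflections as Moebius maps\<close>

lemma reflect_commute: "reflect p q z = reflect q p z"
  by (simp add: reflect_def add.commute mult_ac)

text \<open>A zero would make \<open>z\<close> the midpoint of the chord from \<open>p\<close> to
  \<open>q\<close>; by the parallelogram law a chord with its midpoint on the unit circle is
  degenerate.\<close>

lemma reflect_denominator:
  fixes p q z :: complex
  assumes "norm p = 1" "norm q = 1" "p \<noteq> q" "norm z = 1"
  shows "2 * z - (p + q) \<noteq> 0"
proof
  assume "2 * z - (p + q) = 0"
  then have z: "p + q = 2 * z" by simp
  have "norm (p + q) ^ 2 + norm (p - q) ^ 2 = 2 * (norm p ^ 2 + norm q ^ 2)"
    by (simp only: cmod_power2) (simp add: power2_eq_square algebra_simps)
  moreover have "norm (p + q) = 2" using assms(4) unfolding z norm_mult by simp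
  ultimately have "norm (p - q) = 0" using assms by simp
  then show False using assms(3) by simp
qed

text \<open>The difference formula for Moebius maps; \<open>- (p - q)\<^sup>2\<close> is the
  determinant of the reflection.\<close>

lemma reflect_diff:
  assumes "2 * z - (p + q) \<noteq> 0" "2 * w - (p + q) \<noteq> 0"
  shows "reflect p q z - reflect p q w =
    - (p - q)\<^sup>2 * (z - w) / ((2 * z - (p + q)) * (2 * w - (p + q)))"
proof -
  have "reflect p q z - reflect p q w = (((p + q) * z - 2 * p * q) * (2 * w - (p + q)) -
      ((p + q) * w - 2 * p * q) * (2 * z - (p + q))) / ((2 * z - (p + q)) * (2 * w - (p + q)))"
    unfolding reflect_def by (rule diff_frac_eq[OF assms])
  also have "((p + q) * z - 2 * p * q) * (2 * w - (p + q)) - ((p + q) * w - 2 * p * q) * (2 * z - (p + q)) =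
      - (p - q)\<^sup>2 * (z - w)"
    by (simp add: algebra_simps power2_eq_square)
  finally show ?thesis .
qed

lemma reflect_left: "p \<noteq> q \<Longrightarrow> reflect p q p = p"
  by (simp add: reflect_def divide_simps) (simp add: algebra_simps)

lemma reflect_right: "p \<noteq> q \<Longrightarrow> reflect p q q = q"
  using reflect_left[of q p] by (simp add: reflect_commute)

lemma reflect_eq_left_iff:
  assumes "2 * z - (p + q) \<noteq> 0" "p \<noteq> q"
  shows "reflect p q z = p \<longleftrightarrow> z = p"
proof -
  have "2 * p - (p + q) \<noteq> 0" using assms(2) by (simp add: algebra_simps)
  from reflect_diff[OF assms(1) this] show ?thesis
    using assms reflect_left[of p q] by (auto simp: reflect_left)
qed

text \<open>With \<open>\<kappa> z = (z + p) / (z - p)\<close>, a coordinate sending \<open>p\<close> to infinity, the reflection becomes the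
  Euclidean point reflection in \<open>\<kappa> q\<close>.\<close>

lemma reflect_iff:
  assumes "p \<noteq> 0" "z \<noteq> p" "w \<noteq> p" "q \<noteq> p" "2 * z - (p + q) \<noteq> 0"
  shows "w = reflect p q z \<longleftrightarrow> (w + p) / (w - p) = 2 * ((q + p) / (q - p)) - (z + p) / (z - p)"
proof -
  define N where "N = (2 * z - (p + q)) * w - ((p + q) * z - 2 * p * q)"
  have "(w + p) / (w - p) - (2 * ((q + p) / (q - p)) - (z + p) / (z - p)) =
      ((w + p) * (q - p) * (z - p) - 2 * (q + p) * (w - p) * (z - p) + (z + p) * (w - p) * (q - p)) /
      ((w - p) * (q - p) * (z - p))"
    using assms by (simp add: divide_simps) (simp add: algebra_simps)
  also have "(w + p) * (q - p) * (z - p) - 2 * (q + p) * (w - p) * (z - p) + (z + p) * (w - p) * (q - p) =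
      - 2 * p * N"
    by (simp add: N_def algebra_simps)
  finally have "(w + p) / (w - p) = 2 * ((q + p) / (q - p)) - (z + p) / (z - p) \<longleftrightarrow>
      - 2 * p * N / ((w - p) * (q - p) * (z - p)) = 0"
    by (metis eq_iff_diff_eq_0)
  also have "\<dots> \<longleftrightarrow> N = 0" using assms by simp
  also have "\<dots> \<longleftrightarrow> w = reflect p q z"
    using assms(5) by (auto simp: N_def reflect_def nonzero_eq_divide_eq mult.commute)
  finally show ?thesis by simp
qed

text \<open>The point reflection of \<open>reflect_iff\<close>, written in the coordinate
  \<open>cot\<close> and inverted by \<open>arctan\<close> on the branch with values between
  \<open>p - 1\<close> and \<open>p\<close>. The point \<open>x = p\<close> is separate, as it lies
  at infinity of the coordinate while \<open>cot 0\<close> is 0 by convention.\<close>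

definition reflect_lift :: "real \<Rightarrow> real \<Rightarrow> real \<Rightarrow> real" where
  "reflect_lift p q x = (if x = p then p
     else p - 1/2 - arctan (2 * cot (pi * (q - p)) - cot (pi * (x - p))) / pi)"

lemma reflect_lift_left [simp]: "reflect_lift p q p = p"
  by (simp add: reflect_lift_def)

lemma cot_add_pi [simp]: "cot (x + pi) = cot (x :: real)"
  by (simp add: cot_def)

lemma cot_strict_antimono:
  fixes x y :: real
  assumes "0 < x" "x < y" "y < pi"
  shows "cot y < cot x"
  using tan_monotone[of "pi/2 - y" "pi/2 - x"] assms by (simp add: tan_cot')

lemma cot_inj:
  fixes x y :: real
  assumes "0 < x" "x < pi" "0 < y" "y < pi" "cot x = cot y"
  shows "x = y"
  using assms cot_strict_antimono[of x y] cot_strict_antimono[of y x] by (cases x y rule: linorder_cases) auto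

lemma arctan_cot:
  fixes x :: real
  assumes "0 < x" "x < pi"
  shows "arctan (cot x) = pi / 2 - x"
  using arctan_tan[of "pi/2 - x"] assms by (simp add: tan_cot')

lemma reflect_lift_bounds:
  assumes "x \<noteq> p"
  shows "p - 1 < reflect_lift p q x" "reflect_lift p q x < p"
  using assms arctan_bounded[of "2 * cot (pi * (q - p)) - cot (pi * (x - p))"]
  by (auto simp: reflect_lift_def field_simps)

lemma cot_reflect_lift:
  assumes "x \<noteq> p"
  shows "cot (pi * (reflect_lift p q x - p)) = 2 * cot (pi * (q - p)) - cot (pi * (x - p))"
proof -
  let ?c = "2 * cot (pi * (q - p)) - cot (pi * (x - p))"
  have "pi * (reflect_lift p q x - p) + pi = pi / 2 - arctan ?c"
    using assms by (simp add: reflect_lift_def field_simps)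
  then have "cot (pi * (reflect_lift p q x - p)) = cot (pi / 2 - arctan ?c)"
    by (metis cot_add_pi)
  also have "\<dots> = ?c"
    using tan_cot'[of "pi / 2 - arctan ?c"] by (simp add: tan_arctan)
  finally show ?thesis .
qed

text \<open>The integer \<open>k\<close> selects an interval between consecutive poles of the
  cotangent: \<open>k = 0\<close> serves points right of \<open>p\<close>, and \<open>k = 1\<close>
  points left of it, where the inverse branch lives.\<close>

lemma reflect_lift_strict_antimono:
  assumes "p - of_int k < x" "x < y" "y < p - of_int k + 1"
  shows "reflect_lift p q y < reflect_lift p q x"
proof -
  have per: "cot (pi * (z - p) + pi * of_int k) = cot (pi * (z - p))" for z
    using tan_periodic_int[of "pi * (z - p)" k] by (simp add: cot_altdef mult.commute[of pi])
  have ne: "z \<noteq> p" if "p - of_int k < z" "z < p - of_int k + 1" for z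
  proof
    assume "z = p"
    with that have "0 < k" "k < 1" by linarith+
    then show False by simp
  qed
  have "cot (pi * (y - p) + pi * of_int k) < cot (pi * (x - p) + pi * of_int k)"
  proof (rule cot_strict_antimono)
    have "pi * (y - p) + pi * of_int k = pi * (y - p + of_int k)" by (simp add: algebra_simps)
    also have "\<dots> < pi * 1" using assms by (intro mult_strict_left_mono) auto
    finally show "pi * (y - p) + pi * of_int k < pi" by simp
    have "0 < pi * (x - p + of_int k)" using assms by (intro mult_pos_pos) auto
    then show "0 < pi * (x - p) + pi * of_int k" by (simp add: algebra_simps)
  qed (use assms in simp)
  then have "cot (pi * (y - p)) < cot (pi * (x - p))" by (simp only: per)
  then show ?thesis using ne[of x] ne[of y] assms
    by (auto simp: reflect_lift_def divide_strict_right_mono arctan_less_iff)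
qed

lemma reflect_lift_shift:
  assumes "x \<noteq> p" "x + 1 \<noteq> p"
  shows "reflect_lift p q (x + 1) = reflect_lift p q x"
proof -
  have "pi * (x + 1 - p) = pi * (x - p) + pi" by (simp add: algebra_simps)
  then show ?thesis using assms by (simp add: reflect_lift_def)
qed

text \<open>On the line an orientation-reversing lift cannot fix both ends: \<open>p\<close> stays,
  so \<open>q\<close> drops by a full turn.\<close>

lemma reflect_lift_right:
  assumes "p < q" "q < p + 1"
  shows "reflect_lift p q q = q - 1"
proof -
  have "arctan (cot (pi * (q - p))) = pi / 2 - pi * (q - p)"
    using assms by (intro arctan_cot) (auto simp: mult_less_cancel_left_pos)
  then show ?thesis using assms
    by (simp add: reflect_lift_def arctan_minus field_simps)
qed

text \<open>The two point reflections cancel in the coordinate \<open>cot\<close>; since the result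
  lies left of \<open>p\<close>, it differs from \<open>x\<close> by one turn.\<close>

lemma reflect_lift_involution:
  assumes "p < x" "x < p + 1"
  shows "reflect_lift p q (reflect_lift p q x) + 1 = x"
proof -
  let ?R = "reflect_lift p q"
  have b: "p - 1 < ?R x" "?R x < p" using reflect_lift_bounds[of x p q] assms by auto
  have b': "p - 1 < ?R (?R x)" "?R (?R x) < p" using reflect_lift_bounds[of "?R x" p q] b by auto
  have "cot (pi * (?R (?R x) - p) + pi) = cot (pi * (x - p))"
    using cot_reflect_lift[of "?R x" p q] cot_reflect_lift[of x p q] b assms by simp
  moreover have "pi * (?R (?R x) - p) + pi = pi * (?R (?R x) + 1 - p)" by (simp add: algebra_simps)
  ultimately have "cot (pi * (?R (?R x) + 1 - p)) = cot (pi * (x - p))" by simp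
  then have "pi * (?R (?R x) + 1 - p) = pi * (x - p)"
  proof (rule cot_inj[rotated 4])
    show "pi * (?R (?R x) + 1 - p) < pi" "pi * (x - p) < pi"
      using b' assms by (auto simp: mult_less_cancel_left_pos[of pi _ 1, simplified])
  qed (use b' assms in auto)
  then show ?thesis by simp
qed

lemma to_circle_reflect_lift:
  assumes "p < q" "q < p + 1" "p - 1 < x" "x < p + 1"
  shows "to_circle (reflect_lift p q x) = reflect (to_circle p) (to_circle q) (to_circle x)"
proof (cases "x = p")
  case True
  have "to_circle p \<noteq> to_circle q"
    using assms by (intro to_circle_neq) auto
  then show ?thesis using True by (simp add: reflect_left)
next
  case False
  have ne: "to_circle y \<noteq> to_circle p" if "p - 1 < y" "y < p + 1" "y \<noteq> p" for y
    using that by (intro to_circle_neq) auto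
  let ?w = "reflect_lift p q x"
  have w: "p - 1 < ?w" "?w < p" using reflect_lift_bounds[of x p q] False by auto
  have "of_real (cot (pi * (?w - p))) = (2 * of_real (cot (pi * (q - p))) - of_real (cot (pi * (x - p))) :: complex)"
    using cot_reflect_lift[OF False, of q] by simp
  then have "\<i> * (to_circle ?w + to_circle p) / (to_circle ?w - to_circle p) =
     2 * (\<i> * (to_circle q + to_circle p) / (to_circle q - to_circle p)) -
     \<i> * (to_circle x + to_circle p) / (to_circle x - to_circle p)"
    using ne[of ?w] ne[of q] ne[of x] w assms False by (simp add: to_circle_cot)
  then have "\<i> * ((to_circle ?w + to_circle p) / (to_circle ?w - to_circle p)) =
     \<i> * (2 * ((to_circle q + to_circle p) / (to_circle q - to_circle p)) -
     (to_circle x + to_circle p) / (to_circle x - to_circle p))"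
    by (simp add: right_diff_distrib)
  then have *: "(to_circle ?w + to_circle p) / (to_circle ?w - to_circle p) =
     2 * ((to_circle q + to_circle p) / (to_circle q - to_circle p)) -
     (to_circle x + to_circle p) / (to_circle x - to_circle p)"
    by (rule mult_left_cancel[THEN iffD1, rotated]) simp
  have "2 * to_circle x - (to_circle p + to_circle q) \<noteq> 0"
    using ne[of q] assms by (intro reflect_denominator) auto
  then show ?thesis
    using * ne[of ?w] ne[of q] ne[of x] w assms False by (intro reflect_iff[THEN iffD2]) auto
qed


text \<open>The reflection is symmetric in its two fixed points, whereas \<open>reflect_lift\<close> is defined from the
  left one.\<close>

lemma cot_reflect_lift_right:
  assumes "p < q" "q < p + 1" "p - 1 < x" "x < p + 1" "to_circle x \<noteq> to_circle q"
  shows "cot (pi * (reflect_lift p q x - q)) = 2 * cot (pi * (p - q)) - cot (pi * (x - q))"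
proof -
  let ?P = "to_circle p" and ?Q = "to_circle q" and ?X = "to_circle x" and ?W = "to_circle (reflect_lift p q x)"
  have PQ: "?P \<noteq> ?Q" using assms by (intro to_circle_neq) auto
  have den: "2 * ?X - (?Q + ?P) \<noteq> 0"
    using PQ by (intro reflect_denominator) auto
  have W: "?W = reflect ?Q ?P ?X"
    using assms by (simp add: to_circle_reflect_lift reflect_commute)
  then have WQ: "?W \<noteq> ?Q" using reflect_eq_left_iff[OF den] PQ assms(5) by auto
  have *: "(?W + ?Q) / (?W - ?Q) = 2 * ((?P + ?Q) / (?P - ?Q)) - (?X + ?Q) / (?X - ?Q)"
    using W PQ WQ assms(5) den by (intro reflect_iff[THEN iffD1]) auto
  have "of_real (cot (pi * (reflect_lift p q x - q))) = \<i> * ((?W + ?Q) / (?W - ?Q))"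
    using WQ by (simp add: to_circle_cot)
  also have "\<dots> = of_real (2 * cot (pi * (p - q)) - cot (pi * (x - q)))"
  proof -
    have 1: "\<i> * ((?P + ?Q) / (?P - ?Q)) = of_real (cot (pi * (p - q)))"
      using to_circle_cot[OF PQ] by simp
    have 2: "\<i> * ((?X + ?Q) / (?X - ?Q)) = of_real (cot (pi * (x - q)))"
      using to_circle_cot[OF assms(5)] by simp
    have "\<i> * (2 * u - v) = 2 * (\<i> * u) - \<i> * v" for u v :: complex
      by (simp add: algebra_simps)
    then show ?thesis unfolding * 1 2 by (simp only: 1 2 of_real_diff of_real_mult of_real_numeral)
  qed
  finally show ?thesis by (simp only: of_real_eq_iff)
qed

text \<open>For points distinct from \<open>w\<close>, this says that the numbers
  \<open>1 / (z - w)\<close> at \<open>z0\<close>, \<open>z1\<close>, \<open>z2\<close> are in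
  arithmetic progression: \<open>z1\<close> is the midpoint once \<open>w\<close> is sent to
  infinity. The form without quotients avoids case distinctions.\<close>

definition harmonic :: "complex \<Rightarrow> complex \<Rightarrow> complex \<Rightarrow> complex \<Rightarrow> bool" where
  "harmonic z0 z1 z2 w \<longleftrightarrow> (z0 - z1) * (z2 - w) = (z1 - z2) * (z0 - w)"

text \<open>Invariance of the cross ratio: by \<open>reflect_diff\<close> both sides acquire the
  same factors.\<close>

lemma harmonic_reflect:
  assumes "norm p = 1" "norm q = 1" "p \<noteq> q" "norm z0 = 1" "norm z1 = 1" "norm z2 = 1" "norm w = 1"
    and "harmonic z0 z1 z2 w"
  shows "harmonic (reflect p q z0) (reflect p q z1) (reflect p q z2) (reflect p q w)"
proof -
  note den = reflect_denominator[OF assms(1-3)]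
  define c where "c = - (p - q)\<^sup>2"
  define d where "d z = 2 * z - (p + q)" for z
  have diff: "reflect p q z - reflect p q w = c * (z - w) / (d z * d w)" if "norm z = 1" "norm w = 1" for z w
    unfolding c_def d_def using reflect_diff that den by blast
  have "c * (z0 - z1) / (d z0 * d z1) * (c * (z2 - w) / (d z2 * d w)) =
      c * c * ((z0 - z1) * (z2 - w)) / (d z0 * d z1 * d z2 * d w)" by (simp add: mult_ac)
  moreover have "c * (z1 - z2) / (d z1 * d z2) * (c * (z0 - w) / (d z0 * d w)) =
      c * c * ((z1 - z2) * (z0 - w)) / (d z0 * d z1 * d z2 * d w)" by (simp add: mult_ac)
  ultimately show ?thesis
    using assms by (simp add: harmonic_def diff)
qed

text \<open>With \<open>w\<close> at infinity, \<open>reflect w q\<close> is the point reflection in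
  \<open>q\<close>, so \<open>q\<close> is the midpoint of \<open>p\<close> and its image. This
  harmonic quadruple is then moved by the reflection that fixes \<open>p\<close> and
  \<open>w\<close>.\<close>

lemma harmonic_reflect_chain:
  assumes "norm p = 1" "norm q = 1" "norm w = 1" "p \<noteq> w" "q \<noteq> w" "norm (reflect w q p) = 1"
  shows "harmonic p (reflect p w q) (reflect p w (reflect w q p)) w"
proof -
  have D: "2 * p - (w + q) \<noteq> 0" using assms by (intro reflect_denominator) auto
  have "harmonic p q (reflect w q p) w"
    using D by (simp add: harmonic_def reflect_def divide_simps) (simp add: algebra_simps)
  then have "harmonic (reflect p w p) (reflect p w q) (reflect p w (reflect w q p)) (reflect p w w)"
    using assms by (intro harmonic_reflect) auto
  then show ?thesis using assms by (simp add: reflect_left reflect_right)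
qed

section \<open>Lifted reflections on one cell and their inverses\<close>

lemma reflect_lift_translate: "reflect_lift (p + c) (q + c) (x + c) = reflect_lift p q x + c"
  by (simp add: reflect_lift_def)

lemma reflect_lift_cell:
  assumes "p < q" "q < p + 1" "p \<le> x" "x \<le> q"
  shows "q - 1 \<le> reflect_lift p q x" "reflect_lift p q x \<le> p"
    and "x < q \<Longrightarrow> q - 1 < reflect_lift p q x"
proof -
  show le: "reflect_lift p q x \<le> p"
    using reflect_lift_bounds[of x p q] by (cases "x = p") auto
  show lt: "q - 1 < reflect_lift p q x" if "x < q"
  proof (cases "x = p")
    case False
    then show ?thesis
      using reflect_lift_strict_antimono[of p 0 x q q] that assms by (simp add: reflect_lift_right)
  qed (use assms in simp)
  show "q - 1 \<le> reflect_lift p q x"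
    using lt assms reflect_lift_right[of p q] by (cases "x = q") auto
qed

lemma reflect_lift_antimono:
  assumes "p < q" "q < p + 1" "p \<le> x" "x \<le> y" "y \<le> q"
  shows "reflect_lift p q y \<le> reflect_lift p q x"
proof (cases "x = p \<or> x = y")
  case True
  then show ?thesis using reflect_lift_cell[of p q y] assms by auto
next
  case False
  then show ?thesis using reflect_lift_strict_antimono[of p 0 x y q] assms by simp
qed

text \<open>The inverse of \<open>reflect_lift p q\<close> from \<open>[q - 1, p]\<close> to
  \<open>[p, q]\<close>: by \<open>reflect_lift_involution\<close> it is the same map raised by one
  turn, except at the fixed point \<open>p\<close>.\<close>

definition reflect_back :: "real \<Rightarrow> real \<Rightarrow> real \<Rightarrow> real" where
  "reflect_back p q y = (if y = p then p else reflect_lift p q y + 1)"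

lemma reflect_back_left [simp]: "reflect_back p q p = p"
  by (simp add: reflect_back_def)

lemma to_circle_reflect_back:
  assumes "p < q" "q < p + 1" "q - 1 \<le> y" "y \<le> p"
  shows "to_circle (reflect_back p q y) = reflect (to_circle p) (to_circle q) (to_circle y)"
  using to_circle_reflect_lift[of p q y] to_circle_reflect_lift[of p q p] assms
  by (auto simp: reflect_back_def to_circle_add)

lemma reflect_back_right:
  assumes "p < q" "q < p + 1"
  shows "reflect_back p q (q - 1) = q"
  using assms reflect_lift_shift[of "q - 1" p q] by (simp add: reflect_back_def reflect_lift_right)

lemma reflect_back_cell:
  assumes "p < q" "q < p + 1" "q - 1 \<le> y" "y \<le> p"
  shows "p \<le> reflect_back p q y" "reflect_back p q y \<le> q"
    and "q - 1 < y \<Longrightarrow> reflect_back p q y < q"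
proof -
  show le: "p \<le> reflect_back p q y"
    using reflect_lift_bounds[of y p q] by (cases "y = p") (auto simp: reflect_back_def)
  show lt: "reflect_back p q y < q" if "q - 1 < y"
  proof (cases "y = p")
    case False
    then show ?thesis
      using reflect_lift_strict_antimono[of p 1 "q - 1" y q] that assms reflect_back_right[of p q]
      by (simp add: reflect_back_def)
  qed (use assms in simp)
  show "reflect_back p q y \<le> q"
    using lt assms reflect_back_right[of p q] by (cases "y = q - 1") auto
qed

lemma reflect_lift_back:
  assumes "p < q" "q < p + 1" "q - 1 \<le> y" "y \<le> p"
  shows "reflect_lift p q (reflect_back p q y) = y"
proof (cases "y = p")
  case False
  have b: "p - 1 < reflect_lift p q y" "reflect_lift p q y < p"
    using reflect_lift_bounds[of y p q] False by auto
  have "reflect_lift p q (reflect_back p q y) = reflect_lift p q (reflect_lift p q y)"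
    using False b by (simp add: reflect_back_def reflect_lift_shift)
  also have "\<dots> = reflect_lift p q (reflect_lift p q (y + 1))"
    using False assms by (simp add: reflect_lift_shift)
  also have "\<dots> = y"
    using reflect_lift_involution[of p "y + 1" q] False assms by simp
  finally show ?thesis .
qed simp

lemma reflect_back_lift:
  assumes "p < q" "q < p + 1" "p \<le> x" "x \<le> q"
  shows "reflect_back p q (reflect_lift p q x) = x"
proof (cases "x = p")
  case False
  then show ?thesis
    using reflect_lift_involution[of p x q] reflect_lift_bounds[of x p q] assms
    by (simp add: reflect_back_def)
qed simp

section \<open>The conjugacy on the real line\<close>

text \<open>A lifted partition into \<open>m\<close> arcs. Indexing by all integers lets
  neighbouring cells be addressed across the base point without reduction modulo
  \<open>m\<close>.\<close>

locale circle_cells =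
  fixes m :: nat and p :: "int \<Rightarrow> real"
  assumes m: "m \<ge> 3" and strict_mono: "strict_mono p"
    and period: "p (a + int m) = p a + 1"
begin

lemma period_minus: "p (a - int m) = p a - 1"
  using period[of "a - int m"] by simp

lemma period_Suc: "p (a + int m + 1) = p (a + 1) + 1"
  using period[of "a + 1"] by (simp add: algebra_simps)

lemma period_mult: "p (a + k * int m) = p a + of_int k"
proof (induction k rule: int_induct[of _ 0])
  case (step1 k)
  have "p (a + (k + 1) * int m) = p (a + k * int m + int m)" by (simp add: algebra_simps)
  then show ?case using step1 by (simp add: period)
next
  case (step2 k)
  have "p (a + (k - 1) * int m) = p (a + k * int m - int m)" by (simp add: algebra_simps)
  then show ?case using step2 by (simp add: period_minus)
qed simp

lemma p_less: "a < b \<Longrightarrow> p a < p b"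
  using strict_mono by (simp add: strict_mono_def)

lemma p_le_iff [simp]: "p a \<le> p b \<longleftrightarrow> a \<le> b"
  using strict_mono by (simp add: strict_mono_less_eq)

lemma p_less_iff [simp]: "p a < p b \<longleftrightarrow> a < b"
  using strict_mono by (simp add: strict_mono_less)

lemma cell_width: "p a < p (a + 1)" "p (a + 1) < p a + 1"
  using m by (simp_all flip: period)

definition cell :: "real \<Rightarrow> int" where
  "cell x = (THE a. p a \<le> x \<and> x < p (a + 1))"

lemma cell_unique:
  assumes "p a \<le> x" "x < p (a + 1)" "p b \<le> x" "x < p (b + 1)"
  shows "a = b"
proof -
  have "p a < p (b + 1)" "p b < p (a + 1)" using assms by linarith+
  then show ?thesis by simp
qed

lemma cell_eq:
  assumes "p a \<le> x" "x < p (a + 1)"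
  shows "cell x = a"
  unfolding cell_def by (rule the_equality) (use assms cell_unique in blast)+

lemma cell: "p (cell x) \<le> x" "x < p (cell x + 1)"
proof -
  \<comment> \<open>A full turn of \<open>m\<close> cells containing \<open>x\<close>, which leaves
    finitely many candidates for the cell.\<close>
  define k where "k = \<lfloor>x - p 0\<rfloor>"
  have k: "p (k * int m) \<le> x" "x < p (k * int m + int m)"
    using period_mult[of 0 k] by (simp_all add: k_def period) linarith+
  define A where "A = {a \<in> {k * int m ..< k * int m + int m}. p a \<le> x}"
  have "finite A" unfolding A_def by (rule finite_subset[of _ "{k * int m ..< k * int m + int m}"]) auto
  moreover have "k * int m \<in> A" using k m by (simp add: A_def)
  ultimately have A: "finite A" "k * int m \<in> A" .
  define a where "a = Max A"
  have a: "a \<in> A" using A unfolding a_def by (intro Max_in) auto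
  have "x < p (a + 1)"
  proof (rule ccontr)
    assume *: "\<not> x < p (a + 1)"
    then have "p (a + 1) < p (k * int m + int m)" using k by linarith
    then have "a + 1 \<in> A" using a * by (auto simp: A_def)
    then have "a + 1 \<le> a" unfolding a_def using A by (intro Max_ge) auto
    then show False by simp
  qed
  moreover have "p a \<le> x" using a by (simp add: A_def)
  ultimately show "p (cell x) \<le> x" "x < p (cell x + 1)" using cell_eq[of a x] by simp_all
qed

lemma cell_p [simp]: "cell (p a) = a"
  by (rule cell_eq) auto

lemma cell_mono: "x \<le> y \<Longrightarrow> cell x \<le> cell y"
proof -
  assume "x \<le> y"
  then have "p (cell x) < p (cell y + 1)" using cell(1)[of x] cell(2)[of y] by linarith
  then show ?thesis by simp
qed

lemma cell_shift: "cell (x + 1) = cell x + int m"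
  using cell[of x] by (intro cell_eq) (simp_all add: period period_Suc)

definition lift_map :: "real \<Rightarrow> real" where
  "lift_map x = reflect_lift (p (cell x)) (p (cell x + 1)) x"

definition branch :: "int \<Rightarrow> real \<Rightarrow> real" where
  "branch a y = reflect_back (p a) (p (a + 1)) y"

lemma lift_map_p [simp]: "lift_map (p a) = p a"
  by (simp add: lift_map_def)

lemma lift_map_bounds: "p (cell x + 1) - 1 < lift_map x" "lift_map x \<le> p (cell x)"
  using reflect_lift_cell[OF cell_width, of "cell x" x] cell[of x] by (auto simp: lift_map_def)

lemma lift_map_antimono: "cell x = cell y \<Longrightarrow> x \<le> y \<Longrightarrow> lift_map y \<le> lift_map x"
  using reflect_lift_antimono[OF cell_width, of "cell x" x y] cell[of x] cell[of y] by (auto simp: lift_map_def)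

lemma lift_map_shift: "lift_map (x + 1) = lift_map x + 1"
  by (simp add: lift_map_def cell_shift period period_Suc reflect_lift_translate)

section \<open>The conjugacy as a fixed point\<close>

text \<open>The class preserved by \<open>pullback\<close>: prescribing the values at the partition
  points keeps different cells in the right order.\<close>

definition admissible :: "(real \<Rightarrow> real) \<Rightarrow> bool" where
  "admissible h \<longleftrightarrow> mono h \<and> (\<forall>a. h (p a) = of_int a / m)"

text \<open>On the cell \<open>a\<close>, the lift of \<open>T\<close> is
  \<open>y \<mapsto> a - (m - 1) * y\<close>; its inverse is applied to
  \<open>h (lift_map x)\<close>, so fixed points are exactly the lifted conjugacies.\<close>

definition pullback :: "(real \<Rightarrow> real) \<Rightarrow> real \<Rightarrow> real" where
  "pullback h x = (of_int (cell x) - h (lift_map x)) / (real m - 1)"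

lemma admissible_bounds:
  assumes "admissible h"
  shows "of_int (cell x) / m \<le> h x" "h x \<le> (of_int (cell x) + 1) / m"
proof -
  have mono: "mono h" and hp: "h (p a) = of_int a / m" for a using assms by (auto simp: admissible_def)
  show "of_int (cell x) / m \<le> h x" using monoD[OF mono cell(1)[of x]] by (simp add: hp)
  show "h x \<le> (of_int (cell x) + 1) / m" using monoD[OF mono less_imp_le[OF cell(2)[of x]]] by (simp add: hp)
qed

text \<open>Inside a cell two decreasing maps compose to an increasing one; across cells the bounds
  \<open>low\<close> and \<open>up\<close> separate the values.\<close>

lemma admissible_pullback:
  assumes h: "admissible h"
  shows "admissible (pullback h)"
proof -
  have m1: "real m - 1 > 0" using m by simp
  have hp: "h (p a) = of_int a / m" for a using h by (simp add: admissible_def)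
  have mono: "x \<le> y \<Longrightarrow> h x \<le> h y" for x y using h by (simp add: admissible_def mono_def)
  have low: "of_int (cell x) / m \<le> pullback h x" and up: "pullback h x \<le> (of_int (cell x) + 1) / m" for x
  proof -
    have "h (lift_map x) \<le> h (p (cell x))" using lift_map_bounds[of x] by (intro mono)
    moreover have "h (p (cell x + 1 - int m)) \<le> h (lift_map x)"
      using lift_map_bounds[of x] by (intro mono) (simp add: period_minus)
    ultimately have "h (lift_map x) \<le> of_int (cell x) / m" "(of_int (cell x) + 1) / m - 1 \<le> h (lift_map x)"
      using m by (simp_all add: hp diff_divide_distrib)
    \<comment> \<open>Both bounds are rewritten in the shape of \<open>pullback\<close>, as the
      images of the values of \<open>h\<close> at the ends of the image of the cell.\<close>
    moreover have "of_int (cell x) / m = (of_int (cell x) - of_int (cell x) / m) / (real m - 1)"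
      "(of_int (cell x) + 1) / m = (of_int (cell x) - ((of_int (cell x) + 1) / m - 1)) / (real m - 1)"
      using m1 m by (simp_all add: field_simps)
    ultimately show "of_int (cell x) / m \<le> pullback h x" "pullback h x \<le> (of_int (cell x) + 1) / m"
      unfolding pullback_def using m1 by (metis diff_left_mono divide_right_mono less_imp_le)+
  qed
  have "pullback h x \<le> pullback h y" if "x \<le> y" for x y
  proof (cases "cell x = cell y")
    case True
    then show ?thesis
      using mono[OF lift_map_antimono[OF True that]] m1 by (simp add: pullback_def divide_right_mono)
  next
    case False
    then have "cell x + 1 \<le> cell y" using cell_mono[OF that] by simp
    then have "(of_int (cell x) + 1) / real m \<le> of_int (cell y) / m"
      by (intro divide_right_mono) linarith+
    then show ?thesis using up[of x] low[of y] by linarith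
  qed
  moreover have "pullback h (p a) = of_int a / m" for a
    using m1 m by (simp add: pullback_def hp field_simps)
  ultimately show ?thesis by (simp add: admissible_def mono_def)
qed

primrec approx :: "nat \<Rightarrow> real \<Rightarrow> real" where
  "approx 0 = (\<lambda>x. of_int (cell x) / m)"
| "approx (Suc n) = pullback (approx n)"

lemma admissible_approx: "admissible (approx n)"
proof (induction n)
  case 0
  show ?case by (auto simp: admissible_def mono_def intro!: divide_right_mono cell_mono)
qed (simp add: admissible_pullback)

lemma approx_shift: "approx n (x + 1) = approx n x + 1"
proof (induction n arbitrary: x)
  case 0
  show ?case using m by (simp add: cell_shift add_divide_distrib)
next
  case (Suc n)
  have "real m - 1 \<noteq> 0" using m by simp
  then have "(u + real m - (v + 1)) / (real m - 1) = (u - v) / (real m - 1) + 1" for u v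
    by (simp add: field_simps)
  then show ?case by (simp add: pullback_def cell_shift lift_map_shift Suc)
qed

definition ratio :: real where "ratio = 1 / (real m - 1)"

lemma ratio: "0 < ratio" "ratio \<le> 1 / 2" "ratio < 1"
  using m by (simp_all add: ratio_def field_simps)

lemma pullback_eq: "pullback h x = ratio * (of_int (cell x) - h (lift_map x))"
  by (simp add: pullback_def ratio_def)

text \<open>The first two approximations lie in a common interval of length \<open>1 / m\<close>;
  each further pullback contracts by \<open>ratio\<close>.\<close>

lemma approx_Suc_diff: "\<bar>approx (Suc n) x - approx n x\<bar> \<le> ratio ^ n"
proof (induction n arbitrary: x)
  case 0
  have "1 / real m \<le> 1" using m by simp
  moreover have "(of_int (cell x) + 1) / real m = of_int (cell x) / real m + 1 / m" by (simp add: add_divide_distrib)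
  ultimately show ?case
    using admissible_bounds[OF admissible_approx[of 0], of x] admissible_bounds[OF admissible_approx[of 1], of x]
    by (simp del: approx.simps)
next
  case (Suc n)
  have "approx (Suc (Suc n)) x - approx (Suc n) x = - ratio * (approx (Suc n) (lift_map x) - approx n (lift_map x))"
    by (simp add: pullback_eq algebra_simps)
  then have "\<bar>approx (Suc (Suc n)) x - approx (Suc n) x\<bar> = ratio * \<bar>approx (Suc n) (lift_map x) - approx n (lift_map x)\<bar>"
    using ratio by (simp only: abs_mult)
  also have "\<dots> \<le> ratio * ratio ^ n" using ratio by (intro mult_left_mono Suc) auto
  finally show ?case by simp
qed

definition conj_map :: "real \<Rightarrow> real" where
  "conj_map x = lim (\<lambda>n. approx n x)"

lemma approx_tendsto: "(\<lambda>n. approx n x) \<longlonglongrightarrow> conj_map x"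
proof -
  have "summable (\<lambda>n. approx (Suc n) x - approx n x)"
    by (rule summable_comparison_test[of _ "\<lambda>n. ratio ^ n"])
       (use approx_Suc_diff ratio in \<open>auto simp del: approx.simps intro!: summable_geometric\<close>)
  then have "convergent (\<lambda>n. \<Sum>i<n. approx (Suc i) x - approx i x)"
    by (simp add: summable_iff_convergent)
  then have "convergent (\<lambda>n. approx n x - approx 0 x)"
    by (subst (asm) sum_lessThan_telescope)
  then have "convergent (\<lambda>n. approx n x - approx 0 x + approx 0 x)"
    by (intro convergent_add convergent_const)
  then show ?thesis by (simp add: conj_map_def convergent_LIMSEQ_iff)
qed

lemma admissible_conj_map: "admissible conj_map"
proof -
  have "conj_map x \<le> conj_map y" if "x \<le> y" for x y
    by (rule LIMSEQ_le[OF approx_tendsto approx_tendsto])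
       (use admissible_approx that in \<open>auto simp: admissible_def mono_def\<close>)
  moreover have "conj_map (p a) = of_int a / m" for a
  proof -
    have "(\<lambda>n. approx n (p a)) = (\<lambda>n. of_int a / m)"
      using admissible_approx by (simp add: admissible_def)
    then show ?thesis using approx_tendsto[of "p a"] by (simp add: LIMSEQ_const_iff)
  qed
  ultimately show ?thesis by (simp add: admissible_def mono_def)
qed

lemma conj_map_mono: "x \<le> y \<Longrightarrow> conj_map x \<le> conj_map y"
  using admissible_conj_map by (simp add: admissible_def mono_def)

lemma conj_map_p [simp]: "conj_map (p a) = of_int a / m"
  using admissible_conj_map by (simp add: admissible_def)

lemma conj_map_lift_map: "conj_map x = ratio * (of_int (cell x) - conj_map (lift_map x))"
proof -
  have "(\<lambda>n. approx (Suc n) x) \<longlonglongrightarrow> conj_map x" using approx_tendsto by (rule LIMSEQ_Suc)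
  moreover have "(\<lambda>n. approx (Suc n) x) \<longlonglongrightarrow> ratio * (of_int (cell x) - conj_map (lift_map x))"
    unfolding approx.simps pullback_eq by (intro tendsto_intros approx_tendsto)
  ultimately show ?thesis by (rule LIMSEQ_unique)
qed

lemma ratio_mult [simp]: "(real m - 1) * ratio = 1"
  using m by (simp add: ratio_def)

lemma conj_map_lift_map': "conj_map (lift_map x) = of_int (cell x) - (real m - 1) * conj_map x"
proof -
  have "(real m - 1) * conj_map x = ((real m - 1) * ratio) * (of_int (cell x) - conj_map (lift_map x))"
    by (subst conj_map_lift_map) (simp only: mult.assoc)
  then show ?thesis by simp
qed

lemma conj_map_shift: "conj_map (x + 1) = conj_map x + 1"
proof (rule LIMSEQ_unique)
  show "(\<lambda>n. approx n (x + 1)) \<longlonglongrightarrow> conj_map (x + 1)" by (rule approx_tendsto)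
  show "(\<lambda>n. approx n (x + 1)) \<longlonglongrightarrow> conj_map x + 1"
    unfolding approx_shift by (intro tendsto_intros approx_tendsto)
qed

lemma conj_map_shift_minus: "conj_map (x - 1) = conj_map x - 1"
  using conj_map_shift[of "x - 1"] by simp

lemma branch_bounds:
  assumes "p (a + 1) - 1 \<le> y" "y \<le> p a"
  shows "p a \<le> branch a y" "branch a y \<le> p (a + 1)"
  using reflect_back_cell[OF cell_width assms] by (simp_all add: branch_def)

lemma to_circle_branch:
  assumes "p (a + 1) - 1 \<le> y" "y \<le> p a"
  shows "to_circle (branch a y) = reflect (to_circle (p a)) (to_circle (p (a + 1))) (to_circle y)"
  unfolding branch_def by (rule to_circle_reflect_back[OF cell_width assms])

text \<open>The functional equation for inverse branches, on the closed interval so that branches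
  can be applied at cell ends.\<close>

lemma conj_map_branch:
  assumes "p (a + 1) - 1 \<le> y" "y \<le> p a"
  shows "conj_map (branch a y) = ratio * (of_int a - conj_map y)"
\<comment> \<open>Here the branch ends at \<open>p (a + 1)\<close>, which belongs to the next cell,
  so the known values at partition points are used instead of
  \<open>conj_map_lift_map\<close>.\<close>
proof (cases "y = p (a + 1) - 1")
  case True
  have "branch a y = p (a + 1)"
    unfolding True branch_def by (rule reflect_back_right[OF cell_width])
  moreover have "conj_map y = (of_int a + 1) / m - 1"
    unfolding True conj_map_shift_minus by simp
  ultimately show ?thesis using m by (simp add: ratio_def field_simps)
next
  case False
  then have c: "cell (branch a y) = a"
    using reflect_back_cell[OF cell_width assms] assms by (intro cell_eq) (auto simp: branch_def)
  have "lift_map (branch a y) = y"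
    using reflect_lift_back[OF cell_width assms] by (simp add: lift_map_def c) (simp add: branch_def)
  then show ?thesis using conj_map_lift_map[of "branch a y"] by (simp add: c)
qed

text \<open>The target is pulled back along the expanding map to \<open>y'\<close>, approximated
  there, and the error shrinks by \<open>ratio\<close> when the branch is applied.\<close>

lemma conj_map_dense: "\<exists>z. \<bar>conj_map z - y\<bar> \<le> ratio ^ n"
proof (induction n arbitrary: y)
  case 0
  have "real m > 0" using m by simp
  have "of_int \<lfloor>y * m\<rfloor> \<le> y * m" "y * m \<le> of_int \<lfloor>y * m\<rfloor> + 1" by linarith+
  then have "of_int \<lfloor>y * m\<rfloor> / m \<le> y" "y \<le> of_int \<lfloor>y * m\<rfloor> / m + 1 / m"
    using \<open>real m > 0\<close> by (simp_all add: field_simps)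
  moreover have "1 / real m \<le> 1" using m by simp
  ultimately show ?case by (intro exI[of _ "p \<lfloor>y * m\<rfloor>"]) (simp add: abs_le_iff)
next
  case (Suc n)
  have m0: "real m > 0" using m by simp
  define a where "a = \<lfloor>y * m\<rfloor>"
  define y' where "y' = of_int a - (real m - 1) * y"
  have a: "of_int a \<le> y * m" "y * m \<le> of_int a + 1" unfolding a_def by linarith+
  then have a': "of_int a / m \<le> y" "y \<le> (of_int a + 1) / m" using m0 by (simp_all add: field_simps)
  have y: "y = ratio * (of_int a - y')"
    using m by (simp add: y'_def ratio_def)
  have y': "(of_int a + 1) / m - 1 \<le> y'" "y' \<le> of_int a / m"
  proof -
    have "(real m - 1) * (of_int a / m) \<le> (real m - 1) * y"
      "(real m - 1) * y \<le> (real m - 1) * ((of_int a + 1) / m)"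
      using a' m by (intro mult_left_mono; simp)+
    moreover have "(real m - 1) * (of_int a / m) = of_int a - of_int a / m"
      "(real m - 1) * ((of_int a + 1) / m) = of_int a + 1 - (of_int a + 1) / m"
      using m0 by (simp_all add: field_simps)
    ultimately show "(of_int a + 1) / m - 1 \<le> y'" "y' \<le> of_int a / m" by (simp_all add: y'_def)
  qed
  obtain z where z: "\<bar>conj_map z - y'\<bar> \<le> ratio ^ n" using Suc by blast
  \<comment> \<open>Clamping to the domain of \<open>branch a\<close> does not increase the error,
    because \<open>y'\<close> lies between the values of \<open>conj_map\<close> at its
    ends.\<close>
  define z' where "z' = max (p (a + 1) - 1) (min z (p a))"
  have z'b: "p (a + 1) - 1 \<le> z'" "z' \<le> p a"
    using cell_width[of a] by (auto simp: z'_def)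
  have "\<bar>conj_map z' - y'\<bar> \<le> \<bar>conj_map z - y'\<bar>"
  proof -
    have e: "conj_map (p (a + 1) - 1) = (of_int a + 1) / m - 1" by (simp add: conj_map_shift_minus)
    consider "z < p (a + 1) - 1" "z' = p (a + 1) - 1" | "z > p a" "z' = p a" | "z' = z"
      using cell_width[of a] unfolding z'_def by linarith
    then show ?thesis
      using y' e conj_map_mono[of z "p (a + 1) - 1"] conj_map_mono[of "p a" z] by cases auto
  qed
  with z have "ratio * \<bar>conj_map z' - y'\<bar> \<le> ratio * ratio ^ n"
    using ratio by (intro mult_left_mono) auto
  moreover have "conj_map (branch a z') - y = - ratio * (conj_map z' - y')"
    using conj_map_branch[OF z'b] y by (simp add: algebra_simps)
  then have "\<bar>conj_map (branch a z') - y\<bar> = ratio * \<bar>conj_map z' - y'\<bar>"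
    using ratio by (simp only: abs_mult)
  ultimately show ?case by (intro exI[of _ "branch a z'"]) simp
qed

lemma conj_map_dense': "e > 0 \<Longrightarrow> \<exists>z. \<bar>conj_map z - y\<bar> < e"
proof -
  assume "e > 0"
  then obtain n where "ratio ^ n < e" using real_arch_pow_inv ratio by blast
  then show ?thesis using conj_map_dense[of y n] by (meson le_less_trans)
qed

text \<open>A monotone function with dense range has no jumps.\<close>

lemma continuous_conj_map: "continuous_on UNIV conj_map"
proof -
  have "isCont conj_map x" for x
    unfolding continuous_at_eps_delta
  proof (intro allI impI)
    fix e :: real assume e: "e > 0"
    obtain u where u: "\<bar>conj_map u - (conj_map x - e / 2)\<bar> < e / 2" using conj_map_dense'[of "e/2"] e by auto
    obtain v where v: "\<bar>conj_map v - (conj_map x + e / 2)\<bar> < e / 2" using conj_map_dense'[of "e/2"] e by auto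
    have "conj_map u < conj_map x" "conj_map x < conj_map v" using u v by linarith+
    then have "u < x" "x < v" using conj_map_mono[of x u] conj_map_mono[of v x] by linarith+
    moreover have "dist (conj_map y) (conj_map x) < e" if "u \<le> y" "y \<le> v" for y
      using conj_map_mono[OF that(1)] conj_map_mono[OF that(2)] u v by (auto simp: dist_real_def abs_if split: if_splits)
    with \<open>u < x\<close> \<open>x < v\<close> show "\<exists>d>0. \<forall>y. dist y x < d \<longrightarrow> dist (conj_map y) (conj_map x) < e"
      by (intro exI[of _ "min (x - u) (v - x)"]) (auto simp: dist_real_def)
  qed
  then show ?thesis by (simp add: continuous_at_imp_continuous_on)
qed

end

context circle_cells
begin

lemma to_circle_p_neq: "to_circle (p a) \<noteq> to_circle (p (a + 1))"
proof (rule to_circle_neq)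
  show "\<bar>p a - p (a + 1)\<bar> < 1" using cell_width[of a] by linarith
qed (use cell_width[of a] in linarith)

text \<open>If \<open>conj_map\<close> were constant on \<open>[x, p (a + 1)]\<close>, then so it would be on the image of this interval under the
  parabolic map \<open>z \<mapsto> lift_map (lift_map z + 1)\<close>, which pushes points away from its fixed point
  \<open>p (a + 1)\<close> by a fixed amount in the coordinate \<open>cot\<close>.\<close>

lemma conj_map_flat_step:
  assumes x: "p a < x" "x < p (a + 1)" and flat: "conj_map x = (of_int a + 1) / m"
  defines "d \<equiv> cot (pi * (p (a + 2) - p (a + 1))) - cot (pi * (p a - p (a + 1)))"
  obtains x' where "p a < x'" "x' < p (a + 1)" "conj_map x' = (of_int a + 1) / m"
    and "cot (pi * (x' - p (a + 1))) = cot (pi * (x - p (a + 1))) + 2 * d"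
proof -
  have p2: "p (a + 1 + 1) = p (a + 2)" by (simp add: add.assoc)
  define y where "y = lift_map x"
  define x' where "x' = lift_map (y + 1)"
  have cx: "cell x = a" using x by (intro cell_eq) auto
  have y: "p (a + 1) - 1 < y" "y \<le> p a" using lift_map_bounds[of x] by (simp_all add: y_def cx)
  have "conj_map y = (of_int a + 1) / m - 1"
    using conj_map_lift_map'[of x] m by (simp add: y_def cx flat field_simps)
  then have cy: "conj_map (y + 1) = (of_int a + 1) / m"
    by (simp add: conj_map_shift)
  have "y + 1 < p (a + 2)"
  proof (rule ccontr)
    assume "\<not> y + 1 < p (a + 2)"
    then have "(of_int a + 2) / m \<le> (of_int a + 1) / real m" using conj_map_mono[of "p (a + 2)" "y + 1"] cy by simp
    then show False using m by (simp add: divide_le_cancel)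
  qed
  then have cy1: "cell (y + 1) = a + 1" 
    using y by (intro cell_eq; simp only: p2; linarith)
  have x'b: "p (a + 2) - 1 < x'" "x' \<le> p (a + 1)" 
    using lift_map_bounds[of "y + 1"] unfolding x'_def cy1 p2 by blast+
  have conjx': "conj_map x' = (of_int a + 1) / m"
  proof -
    have "conj_map x' = of_int (a + 1) - (real m - 1) * ((of_int a + 1) / m)"
      using conj_map_lift_map'[of "y + 1"] by (simp only: x'_def cy1 cy)
    then show ?thesis using m by (simp add: field_simps)
  qed
  have "p a < x'"
  proof (rule ccontr)
    assume "\<not> p a < x'"
    then have "(of_int a + 1) / real m \<le> of_int a / real m" using conj_map_mono[of x' "p a"] conjx' by simp
    then show False using m by (simp add: divide_le_cancel)
  qed
  have ne: "y + 1 \<noteq> p (a + 1)" using y by simp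
  have "x' < p (a + 1)"
    unfolding x'_def lift_map_def cy1 using reflect_lift_bounds(2)[OF ne] .
  have "cot (pi * (x' - p (a + 1))) = 2 * cot (pi * (p (a + 2) - p (a + 1))) - cot (pi * (y + 1 - p (a + 1)))"
    unfolding x'_def lift_map_def cy1 using cot_reflect_lift[OF ne] by (simp only: p2)
  also have "cot (pi * (y + 1 - p (a + 1))) = cot (pi * (y - p (a + 1)))"
    using cot_add_pi[of "pi * (y - p (a + 1))"] by (simp add: algebra_simps)
  also have "\<dots> = 2 * cot (pi * (p a - p (a + 1))) - cot (pi * (x - p (a + 1)))"
    unfolding y_def lift_map_def cx using x cell_width[of a]
    by (intro cot_reflect_lift_right to_circle_neq) auto
  finally have "cot (pi * (x' - p (a + 1))) = cot (pi * (x - p (a + 1))) + 2 * d"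
    by (simp add: d_def)
  then show thesis using that \<open>p a < x'\<close> \<open>x' < p (a + 1)\<close> conjx' by blast
qed

text \<open>Iterating \<open>conj_map_flat_step\<close> would increase the coordinate \<kappa>
  linearly, although it is bounded on the cell by its value at \<open>p a\<close>. Strictness
  matches the half-open cells with the half-open intervals of \<open>T\<close>.\<close>

lemma conj_map_strict: "conj_map x < (of_int (cell x) + 1) / m"
proof (rule ccontr)
  define a where "a = cell x"
  define d where "d = cot (pi * (p (a + 2) - p (a + 1))) - cot (pi * (p a - p (a + 1)))"
  define \<kappa> where "\<kappa> z = cot (pi * (z - p (a + 1)))" for z
  define S where "S = {z. p a < z \<and> z < p (a + 1) \<and> conj_map z = (of_int a + 1) / m}"
  have per: "\<kappa> z = cot (pi * (z + 1 - p (a + 1)))" for z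
    using cot_add_pi[of "pi * (z - p (a + 1))"] by (simp add: \<kappa>_def algebra_simps)
  assume "\<not> conj_map x < (of_int (cell x) + 1) / m"
  then have "conj_map x = (of_int a + 1) / m"
    using admissible_bounds[OF admissible_conj_map, of x] by (simp add: a_def)
  moreover from this have "x \<noteq> p a" using m by auto
  ultimately have "x \<in> S" using cell[of x] by (auto simp: S_def a_def)
  \<comment> \<open>Since \<open>m \<ge> 3\<close>, the point \<open>p (a + 2)\<close> comes before
    \<open>p a + 1\<close>; the cotangent is decreasing between poles and \<kappa> has period
    1.\<close>
  have "d > 0"
  proof -
    have "p (a + 2) < p (a + int m)" using m by simp
    then have "p (a + 2) < p a + 1" by (simp add: period)
    moreover have "p (a + 1) < p (a + 2)" by simp
    moreover have "p a < p (a + 1)" by simp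
    ultimately have "cot (pi * (p a + 1 - p (a + 1))) < cot (pi * (p (a + 2) - p (a + 1)))"
      by (intro cot_strict_antimono) auto
    then show ?thesis using per[of "p a"] by (simp add: d_def \<kappa>_def)
  qed
  have bound: "\<kappa> z < \<kappa> (p a)" if "z \<in> S" for z
    using that cell_width[of a] unfolding per by (intro cot_strict_antimono) (auto simp: S_def)
  have "\<exists>z\<in>S. \<kappa> z = \<kappa> x + 2 * d * n" for n :: nat
  proof (induction n)
    case 0
    show ?case using \<open>x \<in> S\<close> by auto
  next
    case (Suc n)
    then obtain z where z: "z \<in> S" "\<kappa> z = \<kappa> x + 2 * d * n" by blast
    then obtain z' where "z' \<in> S" "\<kappa> z' = \<kappa> z + 2 * d"
      using conj_map_flat_step[of a z] by (auto simp: S_def \<kappa>_def d_def)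
    then show ?case using z by (intro bexI[of _ z']) (simp_all add: algebra_simps)
  qed
  then have "\<kappa> x + 2 * d * real n < \<kappa> (p a)" for n :: nat using bound by metis
  moreover obtain n :: nat where "\<kappa> (p a) - \<kappa> x < n * (2 * d)"
    using reals_Archimedean3[of "2 * d"] \<open>d > 0\<close> by auto
  ultimately show False by (smt (verit) mult.commute)
qed

lemma cell_conj_map: "\<lfloor>conj_map x * m\<rfloor> = cell x"
  using admissible_bounds(1)[OF admissible_conj_map, of x] conj_map_strict[of x] m
  by (intro floor_unique) (simp_all add: field_simps)

section \<open>Harmonic quadruples with geometric image distances\<close>

text \<open>\<open>s\<close> is the orientation sign and \<open>C\<close> the scale in the image of
  \<open>conj_map\<close>; only the first three entries of \<open>X\<close> matter.\<close>

definition harmonic_tuple :: "real \<Rightarrow> real \<Rightarrow> (nat \<Rightarrow> real) \<Rightarrow> real \<Rightarrow> bool" where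
  "harmonic_tuple s C X w \<longleftrightarrow>
     harmonic (to_circle (X 0)) (to_circle (X 1)) (to_circle (X 2)) (to_circle w) \<and>
     (\<forall>k\<in>{0,1,2}. conj_map w - conj_map (X k) = s * C * ratio ^ k)"

text \<open>The two neighbours of \<open>w = p (b + 1)\<close> have image distance
  \<open>1 / m\<close> from it, and each branch around \<open>w\<close> multiplies this distance by
  \<open>ratio\<close>. \<open>X1\<close> uses one branch and \<open>X2\<close> two, so the points
  are those of \<open>harmonic_reflect_chain\<close>.\<close>

lemma harmonic_tuple_base:
  obtains X where "harmonic_tuple 1 (1 / m) X (p (b + 1))"
    and "\<forall>k\<in>{0,1,2}. p b \<le> X k \<and> X k \<le> p (b + 2)"
proof -
  have p2: "p (b + 1 + 1) = p (b + 2)" by (simp add: add.assoc)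
  have w2: "p (b + 2) - 1 \<le> p b"
    using m by (simp flip: period_minus)
  define s where "s = branch (b + 1) (p b)"
  define X1 where "X1 = branch b (p (b + 2) - 1)"
  define X2 where "X2 = branch b (s - 1)"
  have r1: "p (b + 1) - 1 \<le> p (b + 2) - 1" by simp
  have sdom: "p (b + 1 + 1) - 1 \<le> p b" "p b \<le> p (b + 1)" 
    unfolding p2 using w2 by simp_all
  have s: "p (b + 1) \<le> s" "s \<le> p (b + 2)" 
    using branch_bounds[OF sdom, unfolded p2] by (simp_all only: s_def)
  have sdom2: "p (b + 1) - 1 \<le> s - 1" "s - 1 \<le> p b" using s w2 by linarith+
  have c1: "to_circle X1 = reflect (to_circle (p b)) (to_circle (p (b + 1))) (to_circle (p (b + 2)))"
    unfolding X1_def to_circle_branch[OF r1 w2] by (simp add: to_circle_diff)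
  have cs: "to_circle s = reflect (to_circle (p (b + 1))) (to_circle (p (b + 2))) (to_circle (p b))"
    unfolding s_def to_circle_branch[OF sdom] by (simp only: p2)
  have c2: "to_circle X2 = reflect (to_circle (p b)) (to_circle (p (b + 1))) (to_circle s)"
    unfolding X2_def to_circle_branch[OF sdom2] by (simp add: to_circle_diff)
  have "harmonic (to_circle (p b)) (to_circle X1) (to_circle X2) (to_circle (p (b + 1)))"
    unfolding c1 c2 cs
  proof (rule harmonic_reflect_chain)
    show "to_circle (p b) \<noteq> to_circle (p (b + 1))" "to_circle (p (b + 2)) \<noteq> to_circle (p (b + 1))"
      using to_circle_p_neq[of b] to_circle_p_neq[of "b + 1"] unfolding p2 by (metis)+
    show "norm (reflect (to_circle (p (b + 1))) (to_circle (p (b + 2))) (to_circle (p b))) = 1"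
      unfolding cs[symmetric] by simp
  qed auto
  moreover have "conj_map (p (b + 1)) - conj_map (p b) = 1 / m"
    by (simp add: add_divide_distrib)
  \<comment> \<open>\<open>branch b\<close> sends \<open>p (b + 1) - 1\<close> to
    \<open>p (b + 1)\<close>. Subtracting this equation cancels the constants; \<open>w'\<close>
    below does the same for \<open>branch (b + 1)\<close>, which fixes
    \<open>p (b + 1)\<close>.\<close>
  moreover have w: "conj_map (p (b + 1)) = ratio * (of_int b - (conj_map (p (b + 1)) - 1))"
    using m by (simp add: ratio_def field_simps)
  have "conj_map (p (b + 1)) - conj_map X1 = ratio * (conj_map (p (b + 2)) - conj_map (p (b + 1)))"
    unfolding X1_def conj_map_branch[OF r1 w2] by (subst w) (simp add: conj_map_shift_minus algebra_simps)
  then have "conj_map (p (b + 1)) - conj_map X1 = 1 / m * ratio"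
    by (simp add: add_divide_distrib)
  moreover have "conj_map (p (b + 1)) - conj_map X2 = ratio * (conj_map s - conj_map (p (b + 1)))"
    unfolding X2_def conj_map_branch[OF sdom2] by (subst w) (simp add: conj_map_shift_minus algebra_simps)
  moreover have w': "conj_map (p (b + 1)) = ratio * (of_int (b + 1) - conj_map (p (b + 1)))"
    using m by (simp add: ratio_def field_simps)
  have "conj_map s - conj_map (p (b + 1)) = ratio * (conj_map (p (b + 1)) - conj_map (p b))"
  proof -
    have "conj_map s = ratio * (of_int (b + 1) - conj_map (p b))"
      unfolding s_def by (rule conj_map_branch[OF sdom])
    then show ?thesis using w' unfolding right_diff_distrib by linarith
  qed
  then have "conj_map s - conj_map (p (b + 1)) = ratio * (1 / m)"
    by (simp add: add_divide_distrib)
  ultimately have "harmonic_tuple 1 (1 / m) (\<lambda>k. if k = 0 then p b else if k = 1 then X1 else X2) (p (b + 1))"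
    by (simp add: harmonic_tuple_def power2_eq_square)
  moreover have "p b \<le> X1" "X1 \<le> p (b + 2)" "p b \<le> X2" "X2 \<le> p (b + 2)"
    using branch_bounds[OF r1 w2] branch_bounds[OF sdom2] p_less[of "b + 1" "b + 2"]
    unfolding X1_def X2_def by linarith+
  ultimately show thesis
    using p_less[of b "b + 2"] by (intro that[of "\<lambda>k. if k = 0 then p b else if k = 1 then X1 else X2"]) auto
qed

text \<open>A branch is a reflection on the circle and acts on image values as an affine map of
  factor \<open>- ratio\<close>, hence the flipped sign.\<close>

lemma harmonic_tuple_branch:
  assumes "harmonic_tuple s C X w" and dom: "\<forall>k\<in>{0,1,2}. p (a + 1) - 1 \<le> X k \<and> X k \<le> p a"
    and w: "p (a + 1) - 1 \<le> w" "w \<le> p a"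
  shows "harmonic_tuple (- s) (ratio * C) (branch a \<circ> X) (branch a w)"
proof -
  have "harmonic (to_circle (branch a (X 0))) (to_circle (branch a (X 1))) (to_circle (branch a (X 2))) (to_circle (branch a w))"
  proof -
    have "to_circle (p a) \<noteq> to_circle (p (a + 1))" 
      by (rule to_circle_p_neq)
    then show ?thesis
      using assms by (simp add: to_circle_branch harmonic_tuple_def harmonic_reflect)
  qed
  moreover have "conj_map (branch a w) - conj_map (branch a (X k)) = - s * (ratio * C) * ratio ^ k" if "k \<in> {0,1,2}" for k
  proof -
    have "conj_map (branch a w) - conj_map (branch a (X k)) = - ratio * (conj_map w - conj_map (X k))"
    proof -
      have d: "p (a + 1) - 1 \<le> X k" "X k \<le> p a" using dom that by blast+
      show ?thesis unfolding conj_map_branch[OF d] conj_map_branch[OF w] by (simp add: algebra_simps)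
    qed
    also have "conj_map w - conj_map (X k) = s * C * ratio ^ k"
      using assms(1) that unfolding harmonic_tuple_def by blast
    finally show ?thesis by simp
  qed
  ultimately show ?thesis by (simp add: harmonic_tuple_def)
qed

text \<open>The point \<open>x\<close> is moved forward by the lifted reflection, a tuple is found
  near its image, and \<open>branch a\<close> brings the tuple back. Closed cells keep the induction
  valid at partition points.\<close>

lemma harmonic_tuple_near:
  assumes "p a \<le> x" "x \<le> p (a + 1)"
  shows "\<exists>X w s. \<bar>s\<bar> = 1 \<and> harmonic_tuple s (ratio / m * ratio ^ n) X w \<and>
    (\<forall>y\<in>{X 0, X 1, X 2, w}. p a \<le> y \<and> y \<le> p (a + 1) \<and> \<bar>conj_map y - conj_map x\<bar> \<le> ratio ^ n)"
  using assms
proof (induction n arbitrary: a x)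
  case 0
  \<comment> \<open>Because \<open>m \<ge> 3\<close>, the cells \<open>a - 2\<close> and
    \<open>a - 1\<close> both lie in the domain of \<open>branch a\<close>; applying it once puts
    the tuple into the cell \<open>a\<close> and yields the factor \<open>ratio\<close>.\<close>
  define b where "b = a - 2"
  have b: "p (b + 2) = p a" "p (a + 1) - 1 \<le> p b"
    using m by (simp_all add: b_def flip: period_minus)
  obtain X where X: "harmonic_tuple 1 (1 / m) X (p (b + 1))" "\<forall>k\<in>{0,1,2}. p b \<le> X k \<and> X k \<le> p (b + 2)"
    by (rule harmonic_tuple_base)
  have dom: "\<forall>k\<in>{0,1,2}. p (a + 1) - 1 \<le> X k \<and> X k \<le> p a"
  proof
    fix k :: nat assume "k \<in> {0,1,2}"
    then have "p b \<le> X k" "X k \<le> p (b + 2)" using X(2) by blast+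
    then show "p (a + 1) - 1 \<le> X k \<and> X k \<le> p a" using b by linarith
  qed
  have w: "p (a + 1) - 1 \<le> p (b + 1)" "p (b + 1) \<le> p a"
  proof -
    have "p b < p (b + 1)" by simp
    then show "p (a + 1) - 1 \<le> p (b + 1)" using b(2) by linarith
    show "p (b + 1) \<le> p a" by (simp add: b_def)
  qed
  have near: "\<bar>conj_map y - conj_map x\<bar> \<le> 1" if "p a \<le> y" "y \<le> p (a + 1)" for y
  proof -
    have "1 / real m \<le> 1" using m by simp
    then show ?thesis
      using that 0 conj_map_mono[of "p a" x] conj_map_mono[of x "p (a + 1)"]
        conj_map_mono[of "p a" y] conj_map_mono[of y "p (a + 1)"] by (simp add: add_divide_distrib)
  qed
  have "harmonic_tuple (- 1) (ratio * (1 / m)) (branch a \<circ> X) (branch a (p (b + 1)))"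
    by (rule harmonic_tuple_branch[OF X(1) dom w])
  moreover have "p a \<le> y \<and> y \<le> p (a + 1)" if "y \<in> {(branch a \<circ> X) 0, (branch a \<circ> X) 1, (branch a \<circ> X) 2, branch a (p (b + 1))}" for y
    using that branch_bounds[OF w] branch_bounds[of a "X 0"] branch_bounds[of a "X 1"] branch_bounds[of a "X 2"] dom
    by auto
  ultimately show ?case
    by (rule_tac exI[of _ "branch a \<circ> X"], rule_tac exI[of _ "branch a (p (b + 1))"], rule_tac exI[of _ "- 1"])
       (use near in \<open>auto simp: comp_def\<close>)
next
  case (Suc n)
  define y where "y = reflect_lift (p a) (p (a + 1)) x"
  have y: "p (a + 1) - 1 \<le> y" "y \<le> p a" unfolding y_def
    using reflect_lift_cell[OF cell_width Suc.prems] by blast+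
  have x: "branch a y = x" unfolding branch_def y_def by (rule reflect_back_lift[OF cell_width Suc.prems])
  \<comment> \<open>If \<open>y = p a\<close>, its own cell leaves the domain of
    \<open>branch a\<close>, so the closed cell to its left is chosen.\<close>
  obtain b where b: "p b \<le> y" "y \<le> p (b + 1)" "b < a" "a + 1 - int m \<le> b"
  proof (cases "y = p a")
    case True
    then show thesis using that[of "a - 1"] m by simp
  next
    case False
    have "p (a + 1 - int m) \<le> y" using y by (simp add: period_minus)
    then have "p (a + 1 - int m) < p (cell y + 1)" "p (cell y) < p a"
      using cell[of y] y False by linarith+
    then show thesis using that[of "cell y"] cell[of y] by simp
  qed
  obtain X w s where IH: "\<bar>s\<bar> = 1" "harmonic_tuple s (ratio / m * ratio ^ n) X w"
    "\<And>z. z \<in> {X 0, X 1, X 2, w} \<Longrightarrow> p b \<le> z \<and> z \<le> p (b + 1) \<and> \<bar>conj_map z - conj_map y\<bar> \<le> ratio ^ n"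
    using Suc.IH[OF b(1,2)] by blast
  have sub: "p (a + 1) - 1 \<le> z" "z \<le> p a" if "z \<in> {X 0, X 1, X 2, w}" for z
  proof -
    have "p (a + 1 - int m) \<le> p b" "p (b + 1) \<le> p a" using b by simp_all
    then show "p (a + 1) - 1 \<le> z" "z \<le> p a" using IH(3)[OF that] period_minus[of "a + 1"] by linarith+
  qed
  have "harmonic_tuple (- s) (ratio * (ratio / m * ratio ^ n)) (branch a \<circ> X) (branch a w)"
    by (rule harmonic_tuple_branch[OF IH(2)]) (use sub in auto)
  then have "harmonic_tuple (- s) (ratio / m * ratio ^ Suc n) (branch a \<circ> X) (branch a w)"
    by (simp add: mult_ac)
  moreover have "p a \<le> branch a z \<and> branch a z \<le> p (a + 1) \<and> \<bar>conj_map (branch a z) - conj_map x\<bar> \<le> ratio ^ Suc n"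
    if z: "z \<in> {X 0, X 1, X 2, w}" for z
  proof -
    have "conj_map (branch a z) - conj_map x = - ratio * (conj_map z - conj_map y)"
      using conj_map_branch[OF sub[OF z]] conj_map_branch[OF y] x by (simp add: algebra_simps)
    then have "\<bar>conj_map (branch a z) - conj_map x\<bar> = ratio * \<bar>conj_map z - conj_map y\<bar>"
      using ratio by (simp only: abs_mult)
    also have "\<dots> \<le> ratio * ratio ^ n" using IH(3)[OF z] ratio by (intro mult_left_mono) auto
    finally show ?thesis using branch_bounds[OF sub[OF z]] by simp
  qed
  ultimately show ?case
    by (rule_tac exI[of _ "branch a \<circ> X"], rule_tac exI[of _ "branch a w"], rule_tac exI[of _ "- s"])
       (use IH(1) in \<open>auto simp: comp_def\<close>)
qed

end

section \<open>Vanishing of the derivative\<close>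

lemma harmonic_chords:
  assumes "harmonic (to_circle x0) (to_circle x1) (to_circle x2) (to_circle w)"
  shows "\<bar>sin (pi * (x0 - x1))\<bar> * \<bar>sin (pi * (x2 - w))\<bar> = \<bar>sin (pi * (x1 - x2))\<bar> * \<bar>sin (pi * (x0 - w))\<bar>"
proof -
  have "norm (to_circle x0 - to_circle x1) * norm (to_circle x2 - to_circle w) =
      norm (to_circle x1 - to_circle x2) * norm (to_circle x0 - to_circle w)"
    using assms unfolding harmonic_def norm_mult[symmetric] by simp
  then show ?thesis by (simp add: dist_to_circle)
qed

text \<open>In the Caratheodory form \<open>sin (pi * z) = g z * z\<close>, the factor
  \<open>g\<close> tends to \<open>pi\<close>, so short chords may be replaced by distances.\<close>

lemma tendsto_scaled_sin:
  fixes d c :: "nat \<Rightarrow> real"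
  assumes "d \<longlonglongrightarrow> 0" "(\<lambda>n. c n * d n) \<longlonglongrightarrow> l"
  shows "(\<lambda>n. \<bar>c n\<bar> * \<bar>sin (pi * d n)\<bar>) \<longlonglongrightarrow> pi * \<bar>l\<bar>"
proof -
  have "((\<lambda>x. sin (pi * x)) has_real_derivative pi) (at 0)"
    by (auto intro!: derivative_eq_intros)
  then obtain g where g: "\<And>z. sin (pi * z) = g z * z" "isCont g 0" "g 0 = pi"
    by (auto simp: CARAT_DERIV)
  have "(\<lambda>n. g (d n)) \<longlonglongrightarrow> pi"
    using isCont_tendsto_compose[OF g(2) assms(1)] g(3) by simp
  then have "(\<lambda>n. \<bar>g (d n) * (c n * d n)\<bar>) \<longlonglongrightarrow> \<bar>pi * l\<bar>"
    using assms(2) by (intro tendsto_intros)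
  moreover have "\<bar>g (d n) * (c n * d n)\<bar> = \<bar>c n\<bar> * \<bar>sin (pi * d n)\<bar>" for n
    unfolding g(1) by (simp add: abs_mult)
  moreover have "\<bar>pi * l\<bar> = pi * \<bar>l\<bar>" by (simp add: abs_mult)
  ultimately show ?thesis by (simp only:)
qed

text \<open>A positive derivative separates the value at \<open>x\<close> strictly from those on
  either side, and monotonicity then traps the preimages.\<close>

lemma mono_tendsto_preimage:
  fixes f :: "real \<Rightarrow> real"
  assumes "mono f" "(f has_real_derivative c) (at x)" "c > 0" "(\<lambda>n. f (X n)) \<longlonglongrightarrow> f x"
  shows "X \<longlonglongrightarrow> x"
proof (rule LIMSEQ_I)
  fix e :: real assume "e > 0"
  obtain d1 where d1: "d1 > 0" "\<And>h. 0 < h \<Longrightarrow> h < d1 \<Longrightarrow> f x < f (x + h)"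
    using DERIV_pos_inc_right[OF assms(2,3)] by auto
  obtain d2 where d2: "d2 > 0" "\<And>h. 0 < h \<Longrightarrow> h < d2 \<Longrightarrow> f (x - h) < f x"
    using DERIV_pos_inc_left[OF assms(2,3)] by auto
  define h where "h = min (e / 2) (min (d1 / 2) (d2 / 2))"
  have h: "0 < h" "h < e" "h < d1" "h < d2" using \<open>e > 0\<close> d1(1) d2(1) by (auto simp: h_def)
  have "\<forall>\<^sub>F n in sequentially. f (x - h) < f (X n)" "\<forall>\<^sub>F n in sequentially. f (X n) < f (x + h)"
    using assms(4) h d1(2)[of h] d2(2)[of h] by (auto intro: order_tendstoD)
  then have "\<forall>\<^sub>F n in sequentially. norm (X n - x) < e"
  proof eventually_elim
    case (elim n)
    have "x - h < X n" using monoD[OF assms(1), of "X n" "x - h"] elim by linarith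
    moreover have "X n < x + h" using monoD[OF assms(1), of "x + h" "X n"] elim by linarith
    ultimately show ?case using h by (auto simp: abs_less_iff)
  qed
  then show "\<exists>no. \<forall>n\<ge>no. norm (X n - x) < e" by (simp add: eventually_sequentially)
qed

context circle_cells
begin

text \<open>Near a point with a positive derivative, \<open>conj_map\<close> is almost linear on all cells around it. So in the
  limit the distances of the points of a harmonic quadruple to its last point would be in the proportion
  \<open>1 : ratio : ratio\<^sup>2\<close>, while those of a tiny harmonic quadruple have reciprocals in arithmetic progression.\<close>

lemma conj_map_derivative_zero:
  assumes deriv: "(conj_map has_real_derivative c) (at x)"
  shows "c = 0"
proof (rule ccontr)
  assume "c \<noteq> 0"
  have mono: "mono conj_map" using conj_map_mono by (simp add: mono_def)
  have "c \<ge> 0"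
  proof (rule ccontr)
    assume "\<not> c \<ge> 0"
    then obtain d where d: "d > 0" "\<And>h. 0 < h \<Longrightarrow> h < d \<Longrightarrow> conj_map (x + h) < conj_map x"
      using DERIV_neg_dec_right[OF deriv] by auto
    show False using d(2)[of "d / 2"] d(1) conj_map_mono[of x "x + d / 2"] by simp
  qed
  with \<open>c \<noteq> 0\<close> have c: "c > 0" by simp
  define C where "C = ratio / m"
  have C: "C > 0" using ratio m by (simp add: C_def)
  have "\<exists>X w s. \<bar>s\<bar> = 1 \<and> harmonic_tuple s (C * ratio ^ n) X w \<and>
    (\<forall>y\<in>{X 0, X 1, X 2, w}. \<bar>conj_map y - conj_map x\<bar> \<le> ratio ^ n)" for n
    using harmonic_tuple_near[of "cell x" x n] cell[of x] unfolding C_def by (meson less_imp_le)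
  then obtain X w s where s: "\<And>n. \<bar>s n\<bar> = 1"
    and tuple: "\<And>n. harmonic_tuple (s n) (C * ratio ^ n) (X n) (w n)"
    and near: "\<And>n y. y\<in>{X n 0, X n 1, X n 2, w n} \<Longrightarrow> \<bar>conj_map y - conj_map x\<bar> \<le> ratio ^ n"
    by metis
  have ratio0: "(\<lambda>n. ratio ^ n) \<longlonglongrightarrow> 0" using ratio by (intro LIMSEQ_power_zero) auto
  have conj_lim: "(\<lambda>n. conj_map (Y n)) \<longlonglongrightarrow> conj_map x" 
    if Y: "\<And>n. Y n \<in> {X n 0, X n 1, X n 2, w n}" for Y
  proof -
    have "(\<lambda>n. conj_map (Y n) - conj_map x) \<longlonglongrightarrow> 0"
      by (rule Lim_null_comparison[OF _ ratio0]) (use near[OF Y] in auto)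
    then show ?thesis by (simp add: LIM_zero_iff)
  qed
  have lim: "Y \<longlonglongrightarrow> x" if Y: "\<And>n. Y n \<in> {X n 0, X n 1, X n 2, w n}" for Y
    by (rule mono_tendsto_preimage[OF mono deriv c conj_lim[OF Y]])
  \<comment> \<open>Caratheodory form of the derivative, with \<open>g\<close> the difference
    quotient based at \<open>x\<close>.\<close>
  obtain g where g: "\<And>z. conj_map z - conj_map x = g z * (z - x)" "isCont g x" "g x = c"
    using deriv by (auto simp: CARAT_DERIV)
  have glim: "(\<lambda>n. g (Y n)) \<longlonglongrightarrow> c" if "Y \<longlonglongrightarrow> x" for Y
    using isCont_tendsto_compose[OF g(2) that] g(3) by simp
  \<comment> \<open>Rescaling by \<open>ratio ^ n\<close>, with the sign, makes the scaled image
    distances independent of \<open>n\<close>.\<close>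
  define \<sigma> where "\<sigma> n = s n / ratio ^ n" for n
  have \<sigma>: "\<bar>\<sigma> n\<bar> * ratio ^ n = 1" for n using s[of n] ratio by (simp add: \<sigma>_def)
  have wlim: "w \<longlonglongrightarrow> x" by (rule lim) simp
  have dist: "(\<lambda>n. \<sigma> n * (w n - X n k)) \<longlonglongrightarrow> C * ratio ^ k / c" if k: "k \<in> {0,1,2}" for k
  proof -
    have Xk: "X n k \<in> {X n 0, X n 1, X n 2, w n}" for n using k by auto
    have Xlim: "(\<lambda>n. X n k) \<longlonglongrightarrow> x" by (rule lim) (rule Xk)
    \<comment> \<open>The quotients \<open>g\<close> are based at \<open>x\<close> rather than at
      the points of the tuple. The resulting error is the bounded \<open>D n\<close> times a
      difference of reciprocal slopes, which vanishes in the limit.\<close>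
    define D where "D n = \<sigma> n * (conj_map (X n k) - conj_map x)" for n
    have D: "\<bar>D n\<bar> \<le> 1" for n
    proof -
      have "\<bar>D n\<bar> \<le> \<bar>\<sigma> n\<bar> * ratio ^ n"
        unfolding D_def abs_mult by (intro mult_left_mono near[OF Xk]) auto
      then show ?thesis using \<sigma>[of n] by simp
    qed
    have "(\<lambda>n. 1 / g (w n) - 1 / g (X n k)) \<longlonglongrightarrow> 1 / c - 1 / c"
      using c by (intro tendsto_intros glim wlim Xlim) auto
    then have "(\<lambda>n. (1 / g (w n) - 1 / g (X n k)) * D n) \<longlonglongrightarrow> 0"
      by (intro lim_null_mult_right_bounded[where B=1]) (use D in auto)
    moreover have "(\<lambda>n. C * ratio ^ k * (1 / g (w n))) \<longlonglongrightarrow> C * ratio ^ k * (1 / c)"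
      using c by (intro tendsto_intros glim wlim) auto
    ultimately have "(\<lambda>n. C * ratio ^ k * (1 / g (w n)) + (1 / g (w n) - 1 / g (X n k)) * D n) \<longlonglongrightarrow> C * ratio ^ k * (1 / c) + 0"
      by (rule tendsto_add[rotated])
    moreover have "\<forall>\<^sub>F n in sequentially. C * ratio ^ k * (1 / g (w n)) + (1 / g (w n) - 1 / g (X n k)) * D n = \<sigma> n * (w n - X n k)"
    proof -
      have "\<forall>\<^sub>F n in sequentially. g (w n) > 0" "\<forall>\<^sub>F n in sequentially. g (X n k) > 0"
        using glim[OF wlim] glim[OF Xlim] c by (auto intro: order_tendstoD)
      then show ?thesis
      proof eventually_elim
        case (elim n)
        have "conj_map (w n) - conj_map (X n k) = s n * (C * ratio ^ n) * ratio ^ k"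
          using tuple[of n] k unfolding harmonic_tuple_def by blast
        then have "\<sigma> n * (conj_map (w n) - conj_map (X n k)) = (s n * s n) * C * ratio ^ k"
          using ratio by (simp add: \<sigma>_def)
        also have "s n * s n = 1" using s[of n] by (metis abs_mult_self_eq mult_1)
        finally have 1: "\<sigma> n * (conj_map (w n) - conj_map (X n k)) = C * ratio ^ k" by simp
        have "w n - X n k = (w n - x) - (X n k - x)" by simp
        also have "w n - x = (conj_map (w n) - conj_map x) / g (w n)" using g(1)[of "w n"] elim by simp
        also have "X n k - x = (conj_map (X n k) - conj_map x) / g (X n k)" using g(1)[of "X n k"] elim by simp
        finally have 2: "w n - X n k = (conj_map (w n) - conj_map x) / g (w n) - (conj_map (X n k) - conj_map x) / g (X n k)" .
        have "t * (u / a - v / b) = t * (u - v) * (1 / a) + (1 / a - 1 / b) * (t * v)" for t u v a b :: real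
          by (simp add: algebra_simps diff_divide_distrib)
        from this[of "\<sigma> n" "conj_map (w n) - conj_map x" "g (w n)" "conj_map (X n k) - conj_map x" "g (X n k)"]
        have "\<sigma> n * (w n - X n k) = \<sigma> n * (conj_map (w n) - conj_map (X n k)) * (1 / g (w n)) + (1 / g (w n) - 1 / g (X n k)) * D n"
          unfolding 2 D_def by simp
        then show ?case unfolding 1 by simp
      qed
    qed
    ultimately show ?thesis by (auto intro: Lim_transform_eventually)
  qed
  define l where "l k = C * ratio ^ k / c" for k
  have d: "(\<lambda>n. \<sigma> n * (w n - X n 0)) \<longlonglongrightarrow> l 0" "(\<lambda>n. \<sigma> n * (w n - X n 1)) \<longlonglongrightarrow> l 1" "(\<lambda>n. \<sigma> n * (w n - X n 2)) \<longlonglongrightarrow> l 2"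
    unfolding l_def by (rule dist; simp)+
  have sc: "(\<lambda>n. \<bar>\<sigma> n\<bar> * \<bar>sin (pi * (Y n - Z n))\<bar>) \<longlonglongrightarrow> pi * \<bar>L\<bar>"
    if "\<And>n. Y n \<in> {X n 0, X n 1, X n 2, w n}" "\<And>n. Z n \<in> {X n 0, X n 1, X n 2, w n}"
      "(\<lambda>n. \<sigma> n * (Y n - Z n)) \<longlonglongrightarrow> L" for Y Z L
    using tendsto_diff[OF lim[OF that(1)] lim[OF that(2)]] that(3) by (intro tendsto_scaled_sin) simp_all
  have 01: "(\<lambda>n. \<sigma> n * (X n 0 - X n 1)) \<longlonglongrightarrow> l 1 - l 0"
    using tendsto_diff[OF d(2) d(1)] by (simp add: algebra_simps)
  have 12: "(\<lambda>n. \<sigma> n * (X n 1 - X n 2)) \<longlonglongrightarrow> l 2 - l 1"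
    using tendsto_diff[OF d(3) d(2)] by (simp add: algebra_simps)
  have 0: "(\<lambda>n. \<sigma> n * (X n 0 - w n)) \<longlonglongrightarrow> - l 0"
    using tendsto_minus[OF d(1)] by (simp add: algebra_simps)
  have 2: "(\<lambda>n. \<sigma> n * (X n 2 - w n)) \<longlonglongrightarrow> - l 2"
    using tendsto_minus[OF d(3)] by (simp add: algebra_simps)
  have lim1: "(\<lambda>n. \<bar>\<sigma> n\<bar> * \<bar>sin (pi * (X n 0 - X n 1))\<bar> * (\<bar>\<sigma> n\<bar> * \<bar>sin (pi * (X n 2 - w n))\<bar>))
      \<longlonglongrightarrow> pi * \<bar>l 1 - l 0\<bar> * (pi * \<bar>- l 2\<bar>)"
    by (intro tendsto_mult sc 01 2) auto
  have lim2: "(\<lambda>n. \<bar>\<sigma> n\<bar> * \<bar>sin (pi * (X n 1 - X n 2))\<bar> * (\<bar>\<sigma> n\<bar> * \<bar>sin (pi * (X n 0 - w n))\<bar>))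
      \<longlonglongrightarrow> pi * \<bar>l 2 - l 1\<bar> * (pi * \<bar>- l 0\<bar>)"
    by (intro tendsto_mult sc 12 0) auto
  have eq: "\<bar>\<sigma> n\<bar> * \<bar>sin (pi * (X n 0 - X n 1))\<bar> * (\<bar>\<sigma> n\<bar> * \<bar>sin (pi * (X n 2 - w n))\<bar>) =
      \<bar>\<sigma> n\<bar> * \<bar>sin (pi * (X n 1 - X n 2))\<bar> * (\<bar>\<sigma> n\<bar> * \<bar>sin (pi * (X n 0 - w n))\<bar>)" for n
  proof -
    have "\<bar>sin (pi * (X n 0 - X n 1))\<bar> * \<bar>sin (pi * (X n 2 - w n))\<bar> = \<bar>sin (pi * (X n 1 - X n 2))\<bar> * \<bar>sin (pi * (X n 0 - w n))\<bar>"
      using tuple[of n] unfolding harmonic_tuple_def by (intro harmonic_chords) blast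
    then show ?thesis by (simp only: mult.assoc mult.left_commute)
  qed
  have "pi * \<bar>l 1 - l 0\<bar> * (pi * \<bar>- l 2\<bar>) = pi * \<bar>l 2 - l 1\<bar> * (pi * \<bar>- l 0\<bar>)"
    by (rule LIMSEQ_unique[OF lim1[unfolded eq] lim2])
  \<comment> \<open>With \<open>l k\<close> proportional to \<open>ratio ^ k\<close>, the limiting
    harmonic relation reduces to \<open>ratio\<^sup>2 = ratio\<close>, impossible for
    \<open>0 < ratio < 1\<close>.\<close>
  then have "\<bar>l 1 - l 0\<bar> * \<bar>l 2\<bar> = \<bar>l 2 - l 1\<bar> * \<bar>l 0\<bar>" by simp
  moreover have "l 1 = ratio * l 0" "l 2 = ratio\<^sup>2 * l 0" "l 0 > 0" using C c by (simp_all add: l_def)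
  ultimately have "\<bar>(ratio - 1) * l 0\<bar> * \<bar>ratio\<^sup>2 * l 0\<bar> = \<bar>ratio * (ratio - 1) * l 0\<bar> * \<bar>l 0\<bar>"
    by (simp add: algebra_simps power2_eq_square)
  then have "\<bar>ratio - 1\<bar> * ratio\<^sup>2 = ratio * \<bar>ratio - 1\<bar>"
    using \<open>l 0 > 0\<close> ratio by (simp add: abs_mult)
  then show False using ratio by (simp add: power2_eq_square)
qed

lemma AE_conj_map_derivative_zero: "AE x in lebesgue. (conj_map has_real_derivative 0) (at x)"
proof -
  have "AE x in lebesgue. \<exists>D. (conj_map has_real_derivative D) (at x)"
    using conj_map_mono by (intro AE_differentiable_mono continuous_conj_map) (simp add: mono_def)
  then show ?thesis
    by (rule AE_mp) (use conj_map_derivative_zero in blast)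
qed

end

section \<open>The conjugacy of \<open>B\<close> and \<open>T\<close>\<close>

lemma Arg2pi_to_circle: "Arg2pi (to_circle x) = 2 * pi * frac x"
proof (rule Arg2pi_unique[of 1])
  have "to_circle x = to_circle (frac x)"
    unfolding to_circle_eq_iff by (simp add: frac_def)
  then show "of_real 1 * exp (\<i> * of_real (2 * pi * frac x)) = to_circle x"
    by (simp add: to_circle_cis cis_conv_exp)
  show "2 * pi * frac x < 2 * pi" using frac_lt_1[of x] by simp
qed simp_all

lemma to_circle_Arg2pi: "norm z = 1 \<Longrightarrow> to_circle (Arg2pi z / (2 * pi)) = z"
  using complex_norm_eq_1_exp[of z] by (simp add: to_circle_cis cis_conv_exp)

lemma of_circle_to_circle: "of_circle (to_circle x) = frac x"
  by (simp add: of_circle_def Arg2pi_to_circle)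

section \<open>Itineraries of the expanding map\<close>

lemma itinerary_0: "itinerary m F P x 0 = (THE a. a < m \<and> x \<in> P a)"
  by (simp add: itinerary_def)

lemma itinerary_Suc: "itinerary m F P x (Suc n) = itinerary m F P (F x) n"
  by (simp add: itinerary_def funpow_swap1)

lemma T01_range: "T01 m x \<in> {0..<1}"
  by (simp add: T01_def frac_lt_1)

lemma J01_unique:
  assumes "0 < m" "y \<in> {0..<1}"
  shows "(THE a. a < m \<and> y \<in> J01 m a) = nat \<lfloor>y * m\<rfloor>"
proof (rule the_equality)
  have "0 \<le> y * m" "y * m < m" using assms by auto
  then have *: "0 \<le> \<lfloor>y * m\<rfloor>" "\<lfloor>y * m\<rfloor> < int m" by (auto simp: floor_less_iff)
  then show "nat \<lfloor>y * m\<rfloor> < m \<and> y \<in> J01 m (nat \<lfloor>y * m\<rfloor>)"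
    using assms(1) by (auto simp: J01_def field_simps nat_less_iff) linarith+
next
  fix a assume "a < m \<and> y \<in> J01 m a"
  then have "real a \<le> y * m" "y * m < real a + 1" using assms by (auto simp: J01_def field_simps)
  then have "\<lfloor>y * m\<rfloor> = int a" by (intro floor_unique) auto
  then show "a = nat \<lfloor>y * m\<rfloor>" by simp
qed

lemma \<psi>_0: "0 < m \<Longrightarrow> y \<in> {0..<1} \<Longrightarrow> \<psi> m y 0 = nat \<lfloor>y * m\<rfloor>"
  by (simp only: \<psi>_def itinerary_0 J01_unique)

lemma \<psi>_Suc: "\<psi> m y (Suc n) = \<psi> m (T01 m y) n"
  by (simp add: \<psi>_def itinerary_Suc)

lemma same_digit_close:
  assumes "0 < m" "x \<in> {0..<1}" "y \<in> {0..<1}" "\<psi> m x = \<psi> m y"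
  shows "\<bar>x - y\<bar> < 1 / m"
proof -
  have "nat \<lfloor>x * m\<rfloor> = nat \<lfloor>y * m\<rfloor>"
    using \<psi>_0[OF assms(1,2)] \<psi>_0[OF assms(1,3)] assms(4) by simp
  moreover have "0 \<le> \<lfloor>x * m\<rfloor>" "0 \<le> \<lfloor>y * m\<rfloor>" using assms by auto
  ultimately have "\<lfloor>x * m\<rfloor> = \<lfloor>y * m\<rfloor>" using eq_nat_nat_iff by blast
  then have "\<bar>x * m - y * m\<bar> < 1" by linarith
  moreover have "\<bar>x * m - y * m\<bar> = \<bar>x - y\<bar> * m" by (simp add: abs_mult flip: left_diff_distrib)
  ultimately show ?thesis using assms(1) by (simp add: field_simps)
qed

text \<open>The expansion formula holds a priori only up to the integer \<open>D\<close>. Equal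
  first digits before and after applying \<open>T01\<close> bound the two terms of \<open>D\<close>
  by \<open>1 / m\<close> and \<open>(m - 1) / m\<close>, so \<open>D\<close> vanishes.\<close>

lemma \<psi>_expanding:
  assumes "2 \<le> m" "x \<in> {0..<1}" "y \<in> {0..<1}" "\<psi> m x = \<psi> m y"
  shows "\<bar>T01 m x - T01 m y\<bar> = (real m - 1) * \<bar>x - y\<bar>" "\<psi> m (T01 m x) = \<psi> m (T01 m y)"
proof -
  have m0: "real m > 0" using assms(1) by simp
  show eq: "\<psi> m (T01 m x) = \<psi> m (T01 m y)"
    using assms(4) \<psi>_Suc by (metis ext)
  define D where "D = (T01 m x - T01 m y) + (real m - 1) * (x - y)"
  have "\<bar>T01 m x - T01 m y\<bar> < 1 / m"
    using assms(1) eq T01_range by (intro same_digit_close) auto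
  moreover have "\<bar>(real m - 1) * (x - y)\<bar> \<le> (real m - 1) * (1 / m)"
    unfolding abs_mult using same_digit_close[of m x y] assms by (intro mult_mono) auto
  moreover have "1 / m + (real m - 1) * (1 / m) = 1" using m0 by (simp add: field_simps)
  ultimately have "\<bar>D\<bar> < 1" unfolding D_def by linarith
  define k where "k = \<lfloor>- (real m - 1) * y\<rfloor> - \<lfloor>- (real m - 1) * x\<rfloor>"
  have D: "D = of_int k"
    by (simp add: D_def T01_def frac_def k_def algebra_simps)
  with \<open>\<bar>D\<bar> < 1\<close> have "k = 0" by linarith
  then have "D = 0" using D by simp
  then have "T01 m x - T01 m y = - ((real m - 1) * (x - y))" by (simp add: D_def)
  then show "\<bar>T01 m x - T01 m y\<bar> = (real m - 1) * \<bar>x - y\<bar>"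
    using assms(1) by (simp add: abs_mult)
qed

text \<open>Points with equal itineraries would separate by the factor \<open>m - 1\<close> at each
  step while staying in the unit interval.\<close>

lemma inj_on_\<psi>:
  assumes "3 \<le> m"
  shows "inj_on (\<psi> m) {0..<1}"
proof (rule inj_onI)
  fix x y assume xy: "x \<in> {0..<1}" "y \<in> {0..<1}" "\<psi> m x = \<psi> m y"
  have "(real m - 1) ^ n * \<bar>x - y\<bar> \<le> 1" if "x \<in> {0..<1}" "y \<in> {0..<1}" "\<psi> m x = \<psi> m y" for n x y
    using that
  proof (induction n arbitrary: x y)
    case (Suc n)
    have "(real m - 1) ^ n * \<bar>T01 m x - T01 m y\<bar> \<le> 1"
      using Suc.prems \<psi>_expanding(2)[of m x y] T01_range assms by (intro Suc.IH) auto
    then show ?case using \<psi>_expanding(1)[of m x y] Suc.prems assms by (simp add: mult_ac)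
  qed auto
  note bound = this[OF xy]
  show "x = y"
  proof (rule ccontr)
    assume "x \<noteq> y"
    moreover have "real m - 1 > 1" using assms by simp
    ultimately obtain n where "1 / \<bar>x - y\<bar> < (real m - 1) ^ n" using real_arch_pow by blast
    then show False using bound[of n] \<open>x \<noteq> y\<close> by (simp add: field_simps)
  qed
qed

section \<open>Reduction of the lifted conjugacy modulo 1\<close>

context circle_cells
begin

lemma conj_map_diff_of_int: "conj_map (x - of_int k) = conj_map x - of_int k"
proof (induction k rule: int_induct[of _ 0])
  case (step1 k)
  then show ?case using conj_map_shift_minus[of "x - of_int k"] by (simp add: diff_diff_add[symmetric])
next
  case (step2 k)
  have *: "x - real_of_int (k - 1) = x - of_int k + 1" by simp
  show ?case unfolding * conj_map_shift using step2 by simp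
qed simp

context
  assumes p_0: "p 0 = 0"
begin

lemma cell_unit: "x \<in> {0..<1} \<Longrightarrow> 0 \<le> cell x \<and> cell x < int m"
proof -
  assume x: "x \<in> {0..<1}"
  have pm: "p (int m) = 1" using period[of 0] p_0 by simp
  have "p 0 < p (cell x + 1)" "p (cell x) < p (int m)" using x cell[of x] p_0 pm by auto
  then show ?thesis by simp
qed

lemma conj_map_unit: "x \<in> {0..<1} \<Longrightarrow> conj_map x \<in> {0..<1}"
proof -
  assume x: "x \<in> {0..<1}"
  have "of_int 0 / real m \<le> conj_map x" 
    using conj_map_mono[of "p 0" x] conj_map_p[of 0] x p_0 by simp
  moreover have "conj_map x < (of_int (cell x) + 1) / m" by (rule conj_map_strict)
  moreover have "(of_int (cell x) + 1) / real m \<le> 1"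
    using cell_unit[OF x] m by (simp add: field_simps)
  ultimately show ?thesis by simp
qed

lemma conj_map_frac: "conj_map (frac x) = frac (conj_map x)"
proof -
  have "conj_map (frac x) = conj_map x - of_int \<lfloor>x\<rfloor>" by (simp add: frac_def conj_map_diff_of_int)
  moreover have "conj_map (frac x) \<in> {0..<1}" by (rule conj_map_unit) (simp add: frac_lt_1)
  ultimately show ?thesis by (metis Ints_of_int atLeastLessThan_iff diff_add_cancel frac_unique_iff add.commute add_diff_cancel_left')
qed

text \<open>The integer \<open>cell x\<close> in \<open>conj_map_lift_map'\<close> disappears under
  \<open>frac\<close>.\<close>

lemma conj_map_T01:
  "T01 m (conj_map x) = conj_map (frac (lift_map x))"
proof -
  have *: "frac (of_int k - z) = frac (- z)" for k and z :: real
    using floor_add_int[of "- z" k] by (simp add: frac_def)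
  then show ?thesis unfolding conj_map_frac conj_map_lift_map' T01_def by (simp only: * mult_minus_left)
qed

end

end

section \<open>The arcs of the partition as cells\<close>

lemma norm_circle_point: "pythagorean_triple t \<Longrightarrow> norm (circle_point t) = 1"
proof -
  assume t: "pythagorean_triple t"
  then have "real_of_int (t $ 3) > 0" "(real_of_int (t $ 1))\<^sup>2 + (real_of_int (t $ 2))\<^sup>2 = (real_of_int (t $ 3))\<^sup>2"
    unfolding pythagorean_triple_def by (auto simp flip: of_int_power of_int_add)
  then have "(norm (circle_point t))\<^sup>2 = 1"
    unfolding circle_point_def cmod_power2 by (simp add: power_divide flip: add_divide_distrib)
  then show ?thesis by (intro power2_eq_imp_eq[of "norm (circle_point t)" 1]) simp_all
qed

locale circle_partition =
  fixes m :: nat and t :: "nat \<Rightarrow> int ^ 3"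
  assumes partition: "unimodular_partition m t" and base: "circle_point (t 0) = 1"
begin

definition angle :: "int \<Rightarrow> real" where
  "angle a = of_circle (circle_point (t (nat (a mod int m)))) + of_int (a div int m)"

lemma m: "m \<ge> 3" using partition by (simp add: unimodular_partition_def)

lemma norm_point: "a < m \<Longrightarrow> norm (circle_point (t a)) = 1"
  using partition by (simp add: unimodular_partition_def norm_circle_point)

lemma angle_nat: "a < m \<Longrightarrow> angle (int a) = of_circle (circle_point (t a))"
  by (simp add: angle_def)

lemma angle_0: "angle 0 = 0"
  using angle_nat[of 0] m base Arg2pi_of_real[of 1] by (simp add: of_circle_def)

lemma to_circle_angle: "to_circle (angle a) = circle_point (t (nat (a mod int m)))"
proof -
  have "nat (a mod int m) < m" using m by (simp add: nat_less_iff)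
  then show ?thesis
    using norm_point unfolding angle_def of_circle_def by (simp add: to_circle_add to_circle_Arg2pi)
qed

text \<open>Within one turn the order is the counterclockwise order, measured from the base point 1;
  between turns it follows from all base angles lying in \<open>[0, 1)\<close>.\<close>

sublocale circle_cells m angle
proof
  show "strict_mono angle"
  proof (rule strict_monoI)
    fix a b :: int assume "a < b"
    have r: "0 \<le> of_circle z" "of_circle z < 1" for z
      using Arg2pi[of z] by (auto simp: of_circle_def)
    show "angle a < angle b"
    proof (cases "a div int m = b div int m")
      case True
      then have "a mod int m < b mod int m"
        using \<open>a < b\<close> by (metis add_less_cancel_left mult_div_mod_eq)
      moreover have "0 \<le> a mod int m" "b mod int m < int m" using m by auto
      moreover have "strict_mono_on {..<m} (\<lambda>a. Arg2pi (circle_point (t a)))"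
        using partition base by (simp add: unimodular_partition_def ccw_ordered_def)
      ultimately have "Arg2pi (circle_point (t (nat (a mod int m)))) < Arg2pi (circle_point (t (nat (b mod int m))))"
        by (intro strict_mono_onD[of "{..<m}" "\<lambda>a. Arg2pi (circle_point (t a))"]) (auto simp: nat_less_iff)
      then show ?thesis using True by (simp add: angle_def of_circle_def divide_strict_right_mono)
    next
      case False
      moreover have "a div int m \<le> b div int m" using \<open>a < b\<close> m by (intro zdiv_mono1) auto
      ultimately have "a div int m + 1 \<le> b div int m" by simp
      then have "real_of_int (a div int m) + 1 \<le> real_of_int (b div int m)" by linarith
      then show ?thesis
        using r(2)[of "circle_point (t (nat (a mod int m)))"] r(1)[of "circle_point (t (nat (b mod int m)))"]
        unfolding angle_def by linarith
    qed
  qed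
qed (use m in \<open>simp_all add: angle_def\<close>)

lemma to_circle_angle_Suc: "to_circle (angle (int a + 1)) = circle_point (t (Suc a mod m))"
  by (simp add: to_circle_angle flip: of_nat_Suc of_nat_mod) (metis nat_int of_nat_Suc of_nat_mod add.commute)

lemma basic_arc_iff:
  assumes x: "x \<in> {0..<1}" and a: "a < m"
  shows "to_circle x \<in> basic_arc m t a \<longleftrightarrow> cell x = int a"
proof -
  have ta: "circle_point (t a) = to_circle (angle (int a))" using a by (simp add: to_circle_angle)
  have pm: "angle (int m) = 1" using period[of 0] angle_0 by simp
  have b: "0 \<le> angle (int a)" "angle (int a + 1) \<le> 1"
    using a angle_0 pm p_le_iff[of 0 "int a"] p_le_iff[of "int a + 1" "int m"] by auto
  have w: "angle (int a) < angle (int a + 1)" "angle (int a + 1) < angle (int a) + 1" by (rule cell_width)+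
  have "angle (int a) < 1" using b w by linarith
  have "to_circle x \<in> basic_arc m t a \<longleftrightarrow> frac (x - angle (int a)) < frac (angle (int a + 1) - angle (int a))"
    unfolding basic_arc_def ccw_arc_def ta to_circle_angle_Suc[symmetric]
    by (simp add: Arg2pi_to_circle flip: to_circle_diff)
  also have "frac (angle (int a + 1) - angle (int a)) = angle (int a + 1) - angle (int a)"
    using w by (simp add: frac_eq)
  \<comment> \<open>A point before the start of the arc is wrapped by one turn and then fails the
    comparison, because no arc extends beyond \<open>angle (int m) = 1\<close>.\<close>
  also have "frac (x - angle (int a)) = (if angle (int a) \<le> x then x - angle (int a) else x - angle (int a) + 1)"
    using x b \<open>angle (int a) < 1\<close> by (auto simp: frac_unique_iff)
  also have "\<dots> < angle (int a + 1) - angle (int a) \<longleftrightarrow> angle (int a) \<le> x \<and> x < angle (int a + 1)"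
    using x b by auto
  also have "\<dots> \<longleftrightarrow> cell x = int a" using cell[of x] cell_eq by metis
  finally show ?thesis .
qed

lemma THE_cell:
  assumes x: "x \<in> {0..<1}"
  shows "(THE a. a < m \<and> to_circle x \<in> basic_arc m t a) = nat (cell x)"
    and "(THE a. a < m \<and> x \<in> I01 m t a) = nat (cell x)"
proof -
  have "(a < m \<and> to_circle x \<in> basic_arc m t a) \<longleftrightarrow> a = nat (cell x)" for a
    using basic_arc_iff[OF x, of a] cell_unit[OF angle_0 x] by auto
  moreover from this have "(a < m \<and> x \<in> I01 m t a) \<longleftrightarrow> a = nat (cell x)" for a
    using x by (simp add: I01_def)
  ultimately show "(THE a. a < m \<and> to_circle x \<in> basic_arc m t a) = nat (cell x)"
    "(THE a. a < m \<and> x \<in> I01 m t a) = nat (cell x)" by simp_all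
qed

lemma B01_eq:
  assumes x: "x \<in> {0..<1}"
  shows "B01 m t x = frac (lift_map x)"
proof -
  have c: "0 \<le> cell x" "cell x < int m" using cell_unit[OF angle_0 x] by auto
  have "Bmap m t (to_circle x) =
      reflect (circle_point (t (nat (cell x)))) (circle_point (t (Suc (nat (cell x)) mod m))) (to_circle x)"
    unfolding Bmap_def THE_cell(1)[OF x] Let_def ..
  also have "\<dots> = reflect (to_circle (angle (cell x))) (to_circle (angle (cell x + 1))) (to_circle x)"
    using c to_circle_angle_Suc[of "nat (cell x)"] by (simp add: to_circle_angle)
  also have "\<dots> = to_circle (lift_map x)"
    unfolding lift_map_def using cell_width[of "cell x"] cell[of x]
    by (intro to_circle_reflect_lift[symmetric]) auto
  finally show ?thesis by (simp add: B01_def of_circle_to_circle)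
qed

text \<open>The conjugacy equation transports orbits, and \<open>cell_conj_map\<close> makes the
  digits agree at each step.\<close>

lemma \<phi>_eq: "x \<in> {0..<1} \<Longrightarrow> \<phi> m t x n = \<psi> m (conj_map x) n"
proof (induction n arbitrary: x)
  case 0
  then show ?case
    using \<psi>_0[of m "conj_map x"] conj_map_unit[OF angle_0] m
    by (simp add: \<phi>_def itinerary_0 THE_cell(2) cell_conj_map)
next
  case (Suc n)
  have "\<phi> m t x (Suc n) = \<phi> m t (frac (lift_map x)) n"
    using Suc.prems by (simp add: \<phi>_def itinerary_Suc B01_eq)
  also have "\<dots> = \<psi> m (conj_map (frac (lift_map x))) n"
    by (rule Suc.IH) (simp add: frac_lt_1)
  also have "\<dots> = \<psi> m (conj_map x) (Suc n)"
    by (simp add: \<psi>_Suc conj_map_T01[OF angle_0])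
  finally show ?case .
qed

lemma \<Phi>_eq: "x \<in> {0..<1} \<Longrightarrow> \<Phi> m t x = conj_map x"
proof -
  assume x: "x \<in> {0..<1}"
  have "\<phi> m t x = \<psi> m (conj_map x)" using \<phi>_eq[OF x] by (rule ext)
  then show ?thesis
    unfolding \<Phi>_def using inv_into_f_f[OF inj_on_\<psi>[OF m] conj_map_unit[OF angle_0 x]] by simp
qed

end

theorem theorem10p1:
  fixes m :: nat and t :: "nat \<Rightarrow> int ^ 3"
  assumes "unimodular_partition m t"
    and "circle_point (t 0) = 1"
  shows "purely_singular (\<Phi> m t)"
proof -
  interpret circle_partition m t using assms by unfold_locales
  \<comment> \<open>\<Phi> agrees with \<open>conj_map\<close> only on \<open>[0, 1)\<close>, so the
    two-sided derivative is first restricted to this interval.\<close>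
  have "(\<Phi> m t has_real_derivative 0) (at x within {0..<1})"
    if "(conj_map has_real_derivative 0) (at x)" "x \<in> {0..<1}" for x
    by (rule has_field_derivative_transform_within[OF has_field_derivative_at_within[OF that(1)], of 1])
       (use \<Phi>_eq that(2) in auto)
  then have "AE x in lebesgue. x \<in> {0..<1} \<longrightarrow> (\<Phi> m t has_real_derivative 0) (at x within {0..<1})"
    using AE_conj_map_derivative_zero by (rule_tac AE_mp) auto
  then show ?thesis by (simp add: purely_singular_def AE_restrict_space_iff)
qed

end
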